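(* Let $b\ge 1$ and $k\ge 2$ be integers, let $K>100$, let $p=p(n)=\frac{\ln^{K} n}{n}$, and let $G\sim \mathcal{G}_{n,p}$. Then a.a.s. $G$ is such that in the $(1:b)$ Maker-Breaker $k$-connectivity game $\mathcal{C}_n^k(G)$ played on the edge set of $G$, Maker has a strategy to win within $\frac{kn}{2}+o(n)$ moves.
   Context: $\mathcal{G}_{n,p}$ is the binomial random graph on $n$ labelled vertices, in which each pair of vertices is an edge independently with probability $p$. $\ln^{K}n=(\ln n)^{K}$. "A.a.s." means with probability tending to $1$ as $n\to\infty$. The parameters $b,k,K$ are fixed and $o(n)$ denotes a (deterministic) function $g(n)$ with $g(n)/n\to 0$. Let $X$ be a finite set (the board) and $\mathcal{F}\subseteq 2^X$ (the winning sets). In the $(a:b)$ Maker-Breaker (weak) game $(X,\mathcal{F})$, two players play in rounds; in each round Maker claims $a$ previously unclaimed elements of $X$ and Breaker claims $b$ previously unclaimed elements of $X$ (or all remaining ones if fewer are left). Maker wins as soon as he has claimed all elements of some $F\in\mathcal{F}$; if all elements of $X$ are claimed without this happening, Breaker wins. Breaker moves first and Maker is the second player. The number of moves is the number of Maker's turns. In the $k$-connectivity game $\mathcal{C}_n^k(G)$ on a graph $G$ with $n$ vertices, the board is $E(G)$ and the winning sets are all edge sets of spanning $k$-(vertex-)connected subgraphs of $G$. *)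

theory Defs
  imports "HOL-Probability.Probability" "HOL-Library.Landau_Symbols"
begin

section \<open>Graphs\<close>

text \<open>
  A simple graph is given by a vertex set \<open>V\<close> and an edge set \<open>E\<close> of two-element subsets of \<open>V\<close>.
\<close>

definition all_edges :: "'a set \<Rightarrow> 'a set set" where
  "all_edges V = {e. e \<subseteq> V \<and> card e = 2}"

definition connected_graph :: "'a set \<Rightarrow> 'a set set \<Rightarrow> bool" where
  "connected_graph V E \<longleftrightarrow>
     V \<noteq> {} \<and> (\<forall>u\<in>V. \<forall>v\<in>V. (u, v) \<in> {(x, y). x \<in> V \<and> y \<in> V \<and> {x, y} \<in> E}\<^sup>*)"

text \<open>
  As usual, a \<open>k\<close>-connected graph must have more than \<open>k\<close> vertices; so the complete graph on
  \<open>k + 1\<close> vertices is \<open>k\<close>-connected, but not \<open>(k + 1)\<close>-connected.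
\<close>

definition k_connected :: "nat \<Rightarrow> 'a set \<Rightarrow> 'a set set \<Rightarrow> bool" where
  "k_connected k V E \<longleftrightarrow>
     card V > k \<and>
     (\<forall>S. S \<subseteq> V \<and> card S < k \<longrightarrow> connected_graph (V - S) {e \<in> E. e \<inter> S = {}})"

definition k_connectivity_sets :: "nat \<Rightarrow> 'a set \<Rightarrow> 'a set set \<Rightarrow> 'a set set set" where
  "k_connectivity_sets k V E = {F. F \<subseteq> E \<and> k_connected k V F}"

section \<open>The binomial random graph\<close>

text \<open>
  The distribution of the edge set of the random graph on the vertices \<open>0, \<dots>, n - 1\<close>. Note that
  \<^const>\<open>bernoulli_pmf\<close> truncates its parameter to the unit interval, which is relevant only
  where an edge probability given by a formula exceeds 1 for small \<open>n\<close>.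
\<close>

definition gnp :: "nat \<Rightarrow> real \<Rightarrow> nat set set pmf" where
  "gnp n p =
     map_pmf (\<lambda>f. {e \<in> all_edges {..<n}. f e})
       (Pi_pmf (all_edges {..<n}) False (\<lambda>_. bernoulli_pmf p))"

section \<open>Maker-Breaker games\<close>

text \<open>
  A history lists the completed rounds in chronological order, each as the pair of the set claimed
  by Breaker, who moves first in the round, and the set then claimed by Maker. Hence the length of
  a history is the number of Maker's turns.
\<close>

type_synonym 'a history = "('a set \<times> 'a set) list"

text \<open>
  Maker's strategy determines his reply from the completed rounds and Breaker's move in the
  current round.
\<close>

type_synonym 'a strategy = "'a history \<Rightarrow> 'a set \<Rightarrow> 'a set"

definition maker_claimed :: "'a history \<Rightarrow> 'a set" where
  "maker_claimed h = (\<Union>(B, M)\<in>set h. M)"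

definition breaker_claimed :: "'a history \<Rightarrow> 'a set" where
  "breaker_claimed h = (\<Union>(B, M)\<in>set h. B)"

definition unclaimed :: "'a set \<Rightarrow> 'a history \<Rightarrow> 'a set" where
  "unclaimed X h = X - (maker_claimed h \<union> breaker_claimed h)"

text \<open>A player with bias \<open>c\<close> claims all of the unclaimed set \<open>A\<close> if it has fewer than \<open>c\<close> elements.\<close>

definition legal_move :: "nat \<Rightarrow> 'a set \<Rightarrow> 'a set \<Rightarrow> bool" where
  "legal_move c A S \<longleftrightarrow> S \<subseteq> A \<and> card S = min c (card A)"

definition maker_won :: "'a set set \<Rightarrow> 'a history \<Rightarrow> bool" where
  "maker_won \<F> h \<longleftrightarrow> (\<exists>F\<in>\<F>. F \<subseteq> maker_claimed h)"

definition game_over :: "'a set \<Rightarrow> 'a set set \<Rightarrow> 'a history \<Rightarrow> bool" where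
  "game_over X \<F> h \<longleftrightarrow> maker_won \<F> h \<or> unclaimed X h = {}"

text \<open>
  The (possibly unfinished) plays in which Maker follows \<open>\<sigma>\<close> against arbitrary legal moves of
  Breaker.
\<close>

inductive play :: "nat \<Rightarrow> 'a set \<Rightarrow> 'a set set \<Rightarrow> 'a strategy \<Rightarrow> 'a history \<Rightarrow> bool"
  for b X \<F> \<sigma> where
  start: "play b X \<F> \<sigma> []"
| round: "play b X \<F> \<sigma> h \<Longrightarrow> \<not> game_over X \<F> h \<Longrightarrow> legal_move b (unclaimed X h) B \<Longrightarrow>
          play b X \<F> \<sigma> (h @ [(B, \<sigma> h B)])"

definition legal_strategy ::
  "nat \<Rightarrow> nat \<Rightarrow> 'a set \<Rightarrow> 'a set set \<Rightarrow> 'a strategy \<Rightarrow> bool" where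
  "legal_strategy a b X \<F> \<sigma> \<longleftrightarrow>
     (\<forall>h B. play b X \<F> \<sigma> h \<and> \<not> game_over X \<F> h \<and> legal_move b (unclaimed X h) B \<longrightarrow>
            legal_move a (unclaimed X h - B) (\<sigma> h B))"

text \<open>
  In the \<open>(a:b)\<close> game with finite board \<open>X\<close> and winning sets \<open>\<F>\<close>, Maker, as second player, has a
  strategy to win within \<open>t\<close> moves. Plays stop as soon as the game is over.
\<close>

definition maker_wins_within ::
  "nat \<Rightarrow> nat \<Rightarrow> 'a set \<Rightarrow> 'a set set \<Rightarrow> real \<Rightarrow> bool" where
  "maker_wins_within a b X \<F> t \<longleftrightarrow>
     (\<exists>\<sigma>. legal_strategy a b X \<F> \<sigma> \<and>
          (\<forall>h. play b X \<F> \<sigma> h \<longrightarrow>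
               real (length h) \<le> t \<and> (game_over X \<F> h \<longrightarrow> maker_won \<F> h)))"

end

theory Submission
  imports Defs "HOL-Real_Asymp.Real_Asymp"
begin

text \<open>
  Fix \<open>\<epsilon> > 0\<close>. Split the vertices into a small core \<open>U\<close> of about \<open>k n / ln\<^sup>K\<^sup>-\<^sup>2 n\<close> vertices and the
  rest \<open>W\<close>, and split \<open>W\<close> into classes of equal size indexed by \<open>k - 1\<close> colours and a constant number
  \<open>L\<close> of layers. Maker wants a matching between any two classes of one colour in consecutive layers
  and between any two classes of different colours in one layer. A vertex of an inner layer is
  to have \<open>k\<close> neighbours in \<open>W\<close>, one from each of its matchings, so this costs at most \<open>k n / 2\<close> edges.
  Vertices in an end layer or missing a partner are called loose. If the core is \<open>k\<close>-connected in
  Maker's graph and each loose vertex has \<open>k\<close> neighbours in it, then the whole graph is \<open>k\<close>-connected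
  (\<open>k_connected_if_hit\<close>): from any vertex, the two directions within its colour and its partners in
  the other colours give \<open>k\<close> disjoint routes to loose vertices and on to the core.

  The matchings can be built greedily: Breaker claims only \<open>O(n)\<close> edges in total, whereas any two
  disjoint sets of linear size span many more edges of the random graph. So when no matching edge can
  be added, only a small fraction of the vertices is loose, and Maker attaches these to the core one by one. What needs care is that Breaker might
  cut the core, or the core edges at a vertex, before Maker gets there. This is a game in which Maker
  has to hit every set of a family before Breaker fills it: the edge cuts of the core, and for each
  vertex \<open>v\<close> of \<open>W\<close> and each of \<open>k\<close> disjoint parts of the core the set of edges from \<open>v\<close> to that part. An
  Erdos-Selfridge potential settles it (\<open>total_danger_step\<close>), because all these sets have
  size of order at least \<open>ln\<^sup>2 n\<close>. To stay fast, Maker disregards the edges from \<open>v\<close> to a part until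
  Breaker owns \<open>\<tau>\<close> of them, for a large constant \<open>\<tau>\<close>. So the number of such forced moves is at most \<open>1/\<tau>\<close>
  times the number of Breaker's edges, and the core has \<open>o(n)\<close> edges altogether. Hence Maker
  needs at most \<open>k n / 2 + \<epsilon> n\<close> moves (\<open>card_Maker_le\<close>).

  The random graph has the required edge counts by Chernoff bounds and union bounds
  (\<open>prob_maker_wins_ge\<close>). Letting \<open>\<epsilon>\<close> tend to \<open>0\<close> slowly yields the error term
  (\<open>diagonal_error_term\<close>).
\<close>

section \<open>Strategies from invariants\<close>

text \<open>
  Maker's strategy may be memoryless: it suffices that, from every position satisfying the
  invariant in which he has not won, he can answer each move of Breaker so as to restore it. The
  case in which Breaker claims nothing shows that Maker has won once the board is exhausted.
\<close>

lemma maker_wins_by_invariant: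
  fixes X :: "'a set" and \<F> :: "'a set set" and Inv :: "'a set \<Rightarrow> 'a set \<Rightarrow> bool"
  assumes fin: "finite X"
    and init: "Inv {} {}"
    and step: "\<And>M B D. \<lbrakk>Inv M B; M \<subseteq> X; B \<subseteq> X; M \<inter> B = {}; \<not> (\<exists>F\<in>\<F>. F \<subseteq> M);
        D \<subseteq> X - (M \<union> B); card D \<le> b\<rbrakk> \<Longrightarrow> \<exists>e\<in>X - (M \<union> B) - D. Inv (insert e M) (B \<union> D)"
    and bound: "\<And>M B. Inv M B \<Longrightarrow> real (card M) \<le> t"
  shows "maker_wins_within 1 b X \<F> t"
proof -
  define good where "good M B D e \<longleftrightarrow> e \<in> X - (M \<union> B) - D \<and> Inv (insert e M) (B \<union> D)"
    for M B D e
  define \<sigma> where "\<sigma> h D = {SOME e. good (maker_claimed h) (breaker_claimed h) D e}" for h D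
  define ok where "ok h \<longleftrightarrow> maker_claimed h \<subseteq> X \<and> breaker_claimed h \<subseteq> X \<and>
      maker_claimed h \<inter> breaker_claimed h = {} \<and> Inv (maker_claimed h) (breaker_claimed h) \<and>
      card (maker_claimed h) = length h" for h
  have reply: "\<exists>e. \<sigma> h D = {e} \<and> good (maker_claimed h) (breaker_claimed h) D e"
    if "ok h" "\<not> game_over X \<F> h" "legal_move b (unclaimed X h) D" for h D
  proof -
    have "D \<subseteq> X - (maker_claimed h \<union> breaker_claimed h)" "card D \<le> b"
      using that(3) by (auto simp: legal_move_def unclaimed_def)
    moreover have "\<not> (\<exists>F\<in>\<F>. F \<subseteq> maker_claimed h)"
      using that(2) by (auto simp: game_over_def maker_won_def)
    ultimately have "\<exists>e. good (maker_claimed h) (breaker_claimed h) D e"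
      using step[of "maker_claimed h" "breaker_claimed h" D] that(1)
      unfolding ok_def good_def by blast
    from someI_ex[OF this] show ?thesis by (auto simp: \<sigma>_def)
  qed
  have ok: "ok h" if "play b X \<F> \<sigma> h" for h
    using that
  proof induction
    case start
    then show ?case by (auto simp: ok_def init maker_claimed_def breaker_claimed_def)
  next
    case (round h B)
    obtain e where e: "\<sigma> h B = {e}" "good (maker_claimed h) (breaker_claimed h) B e"
      using reply round by blast
    have M: "maker_claimed (h @ [(B, \<sigma> h B)]) = insert e (maker_claimed h)"
      and B: "breaker_claimed (h @ [(B, \<sigma> h B)]) = breaker_claimed h \<union> B"
      by (auto simp: e maker_claimed_def breaker_claimed_def)
    have sub: "B \<subseteq> X - (maker_claimed h \<union> breaker_claimed h)"
      using round by (auto simp: legal_move_def unclaimed_def)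
    have "finite (maker_claimed h)"
      using round.IH fin finite_subset by (auto simp: ok_def)
    then show ?case
      using e(2) round.IH sub unfolding ok_def M B good_def by auto
  qed
  have "legal_strategy 1 b X \<F> \<sigma>"
    unfolding legal_strategy_def
  proof (intro allI impI, elim conjE)
    fix h B
    assume h: "play b X \<F> \<sigma> h" "\<not> game_over X \<F> h" "legal_move b (unclaimed X h) B"
    obtain e where e: "\<sigma> h B = {e}" "good (maker_claimed h) (breaker_claimed h) B e"
      using reply ok h by blast
    have in_X: "e \<in> unclaimed X h - B" using e(2) by (auto simp: good_def unclaimed_def)
    moreover have "finite (unclaimed X h - B)" using fin by (auto simp: unclaimed_def)
    ultimately have "card (unclaimed X h - B) \<ge> 1"
      by (metis One_nat_def Suc_leI card_gt_0_iff empty_iff)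
    then show "legal_move 1 (unclaimed X h - B) (\<sigma> h B)"
      using in_X by (auto simp: legal_move_def e(1))
  qed
  moreover have "real (length h) \<le> t \<and> (game_over X \<F> h \<longrightarrow> maker_won \<F> h)"
    if "play b X \<F> \<sigma> h" for h
  proof
    have h: "ok h" using ok that .
    show "real (length h) \<le> t" using h bound unfolding ok_def by metis
    show "game_over X \<F> h \<longrightarrow> maker_won \<F> h"
    proof (intro impI, rule ccontr)
      assume "game_over X \<F> h" and nw: "\<not> maker_won \<F> h"
      then have "X - (maker_claimed h \<union> breaker_claimed h) = {}"
        by (auto simp: game_over_def unclaimed_def)
      then show False
        using step[of "maker_claimed h" "breaker_claimed h" "{}"] h nw
        unfolding ok_def maker_won_def by auto
    qed
  qed
  ultimately show ?thesis unfolding maker_wins_within_def by blast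
qed

section \<open>Hitting sets before Breaker fills them\<close>

text \<open>
  Maker has to claim an element of each member of \<open>H\<close> before Breaker has claimed all of it. He pays
  attention to \<open>F\<close> only once Breaker owns \<open>\<theta> F\<close> of its elements. After that happens in the middle of a
  round of Breaker, up to \<open>b\<close> elements may be lost before Maker reacts, hence the summand \<open>b\<close> below:
  the danger of a set grows, by a factor of at most \<open>2\<^sup>1\<^sup>/\<^sup>b\<close> per element, only in rounds before which Maker
  already paid attention to it.
\<close>

locale hitting_game =
  fixes H :: "'a set set" and \<theta> :: "'a set \<Rightarrow> nat" and b :: nat
  assumes finite_H: "finite H" and finite_mem: "\<And>F. F \<in> H \<Longrightarrow> finite F" and b_pos: "b \<ge> 1"
begin

definition danger :: "'a set \<Rightarrow> 'a set \<Rightarrow> real" where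
  "danger B F = 2 powr ((real (max (card (F \<inter> B)) (\<theta> F + b)) - real (card F)) / real b)"

definition total_danger :: "'a set \<Rightarrow> 'a set \<Rightarrow> real" where
  "total_danger M B = (\<Sum>F\<in>{F\<in>H. F \<inter> M = {}}. danger B F)"

definition urgency :: "'a set \<Rightarrow> 'a set \<Rightarrow> 'a \<Rightarrow> real" where
  "urgency M B e = (\<Sum>F\<in>{F\<in>H. e \<in> F \<and> F \<inter> M = {} \<and> \<theta> F \<le> card (F \<inter> B)}. danger B F)"

lemma danger_nonneg: "danger B F \<ge> 0"
  by (simp add: danger_def)

lemma urgency_pos_iff:
  "urgency M B e > 0 \<longleftrightarrow> (\<exists>F\<in>H. e \<in> F \<and> F \<inter> M = {} \<and> \<theta> F \<le> card (F \<inter> B))"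
proof
  assume "urgency M B e > 0"
  then have "{F\<in>H. e \<in> F \<and> F \<inter> M = {} \<and> \<theta> F \<le> card (F \<inter> B)} \<noteq> {}"
    unfolding urgency_def by (metis less_irrefl sum.empty)
  then show "\<exists>F\<in>H. e \<in> F \<and> F \<inter> M = {} \<and> \<theta> F \<le> card (F \<inter> B)" by auto
next
  assume "\<exists>F\<in>H. e \<in> F \<and> F \<inter> M = {} \<and> \<theta> F \<le> card (F \<inter> B)"
  then have "{F\<in>H. e \<in> F \<and> F \<inter> M = {} \<and> \<theta> F \<le> card (F \<inter> B)} \<noteq> {}" by auto
  then show "urgency M B e > 0"
    unfolding urgency_def by (intro sum_pos) (auto simp: danger_def finite_H)
qed

lemma two_powr_le: "0 \<le> x \<Longrightarrow> x \<le> 1 \<Longrightarrow> 2 powr x \<le> 1 + (x::real)"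
  using Youngs_inequality_0[of x "1 - x" 2 1] by simp

text \<open>
  Since \<open>2\<^sup>x \<le> 1 + x\<close> on the unit interval, the growth over a whole round is bounded by a sum over
  the single elements claimed, so the order in which Breaker claims them does not matter.
\<close>

lemma danger_step:
  assumes F: "F \<in> H" and D: "finite D" "card D \<le> b"
  shows "danger (B \<union> D) F \<le> danger B F +
    (if \<theta> F \<le> card (F \<inter> B) then danger B F * (real (card (F \<inter> D)) / real b) else 0)"
proof -
  have fin: "finite F" using F by (rule finite_mem)
  let ?j = "card (F \<inter> D)"
  have j: "?j \<le> b" using D by (meson Int_lower2 card_mono le_trans)
  have c: "card (F \<inter> (B \<union> D)) \<le> card (F \<inter> B) + ?j"
    by (metis Int_Un_distrib card_Un_le)
  have c': "card (F \<inter> B) \<le> card (F \<inter> (B \<union> D))"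
    using fin by (intro card_mono) auto
  show ?thesis
  proof (cases "\<theta> F \<le> card (F \<inter> B)")
    case True
    have "danger (B \<union> D) F \<le>
        2 powr ((real (max (card (F \<inter> B)) (\<theta> F + b)) - real (card F)) / real b + real ?j / real b)"
      unfolding danger_def using c b_pos
      by (intro powr_mono) (auto simp: divide_simps)
    also have "\<dots> = danger B F * 2 powr (real ?j / real b)"
      by (simp add: danger_def powr_add)
    also have "\<dots> \<le> danger B F * (1 + real ?j / real b)"
      using j b_pos by (intro mult_left_mono two_powr_le danger_nonneg) auto
    finally show ?thesis using True by (simp add: algebra_simps)
  next
    case False
    then have "max (card (F \<inter> (B \<union> D))) (\<theta> F + b) = max (card (F \<inter> B)) (\<theta> F + b)"
      using c c' j by auto
    then show ?thesis using False by (simp add: danger_def)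
  qed
qed

text \<open>
  Maker's element removes at least its own urgency from the total. Each of the at most \<open>b\<close> elements of
  Breaker's next move adds at most \<open>1/b\<close> of its urgency, which is no larger. The hypothesis also allows
  an arbitrary element for Maker when all urgencies vanish.
\<close>

lemma total_danger_step:
  assumes D: "finite D" "card D \<le> b"
    and max: "\<And>e'. e' \<in> D \<Longrightarrow> urgency M B e' \<le> urgency M B e"
  shows "total_danger (insert e M) (B \<union> D) \<le> total_danger M B"
proof -
  define A where "A = {F\<in>H. F \<inter> M = {} \<and> \<theta> F \<le> card (F \<inter> B)}"
  have finA: "finite A" by (simp add: A_def finite_H)
  have "total_danger (insert e M) (B \<union> D) \<le> (\<Sum>F\<in>{F\<in>H. F \<inter> insert e M = {}}. danger B F +
      (if \<theta> F \<le> card (F \<inter> B) then danger B F * (real (card (F \<inter> D)) / real b) else 0))"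
    unfolding total_danger_def using D by (intro sum_mono danger_step) auto
  also have "\<dots> = (\<Sum>F\<in>{F\<in>H. F \<inter> insert e M = {}}. danger B F) +
      (\<Sum>F\<in>{F\<in>H. F \<inter> insert e M = {}}.
        if \<theta> F \<le> card (F \<inter> B) then danger B F * (real (card (F \<inter> D)) / real b) else 0)"
    by (rule sum.distrib)
  also have "(\<Sum>F\<in>{F\<in>H. F \<inter> insert e M = {}}.
        if \<theta> F \<le> card (F \<inter> B) then danger B F * (real (card (F \<inter> D)) / real b) else 0)
      = (\<Sum>F\<in>{F\<in>{F\<in>H. F \<inter> insert e M = {}}. \<theta> F \<le> card (F \<inter> B)}.
          danger B F * (real (card (F \<inter> D)) / real b))"
    using finite_H by (intro sum.inter_filter[symmetric]) auto
  also have "\<dots> \<le> (\<Sum>F\<in>A. danger B F * (real (card (F \<inter> D)) / real b))"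
    using finA by (intro sum_mono2) (auto simp: A_def danger_nonneg)
  also have "\<dots> = (\<Sum>F\<in>A. \<Sum>e'\<in>D. (if e' \<in> F then danger B F else 0)) / real b"
  proof -
    have "real (card (F \<inter> D)) * danger B F = (\<Sum>e'\<in>D. (if e' \<in> F then danger B F else 0))" for F
      using D by (simp add: sum.If_cases Int_def conj_commute)
    then show ?thesis by (simp add: sum_divide_distrib mult.commute)
  qed
  also have "\<dots> = (\<Sum>e'\<in>D. \<Sum>F\<in>A. (if e' \<in> F then danger B F else 0)) / real b"
    by (subst sum.swap) simp
  also have "\<dots> = (\<Sum>e'\<in>D. urgency M B e') / real b"
  proof -
    have "(\<Sum>F\<in>A. (if e' \<in> F then danger B F else 0)) = urgency M B e'" for e'
      unfolding urgency_def sum.inter_filter[OF finA, symmetric]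
      by (intro sum.cong) (auto simp: A_def)
    then show ?thesis by simp
  qed
  also have "\<dots> \<le> urgency M B e"
  proof -
    have nn: "urgency M B e \<ge> 0" unfolding urgency_def by (intro sum_nonneg danger_nonneg)
    have "(\<Sum>e'\<in>D. urgency M B e') \<le> real (card D) * urgency M B e"
      using max by (intro sum_bounded_above) auto
    also have "\<dots> \<le> real b * urgency M B e" using D nn by (intro mult_right_mono) auto
    finally show ?thesis using b_pos by (simp add: divide_simps mult.commute)
  qed
  also have "(\<Sum>F\<in>{F\<in>H. F \<inter> insert e M = {}}. danger B F) + urgency M B e \<le>
      (\<Sum>F\<in>{F\<in>H. F \<inter> insert e M = {}}. danger B F) +
      (\<Sum>F\<in>{F\<in>H. e \<in> F \<and> F \<inter> M = {}}. danger B F)"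
    unfolding urgency_def using finite_H
    by (intro add_left_mono sum_mono2) (auto simp: danger_nonneg)
  also have "\<dots> \<le> total_danger M B"
    unfolding total_danger_def using finite_H
    by (subst sum.union_disjoint[symmetric]) (auto intro!: sum_mono2 simp: danger_nonneg)
  finally show ?thesis by simp
qed

lemma total_danger_start:
  assumes "finite D" "card D \<le> b"
  shows "total_danger {} D = total_danger {} {}"
proof -
  have "danger D F = danger {} F" for F
  proof -
    have "card (F \<inter> D) \<le> b" using assms by (meson Int_lower2 card_mono le_trans)
    then show ?thesis by (simp add: danger_def max_def)
  qed
  then show ?thesis by (simp add: total_danger_def)
qed

text \<open>
  A set filled by Breaker and not hit by Maker has danger at least \<open>1\<close>.
\<close>

lemma not_filled:
  assumes "total_danger M B < 1" "F \<in> H" "F \<inter> M = {}"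
  shows "\<not> F \<subseteq> B"
proof
  assume "F \<subseteq> B"
  then have "F \<inter> B = F" by blast
  then have "1 \<le> danger B F"
    unfolding danger_def by (intro ge_one_powr_ge_zero) auto
  also have "\<dots> \<le> total_danger M B"
    unfolding total_danger_def using assms finite_H
    by (intro member_le_sum) (auto simp: danger_nonneg)
  finally show False using assms by simp
qed

end

section \<open>A sparse shape that forces k-connectivity\<close>

definition pairs :: "'a set \<Rightarrow> 'a set \<Rightarrow> 'a set set" where
  "pairs A B = {{x, y} | x y. x \<in> A \<and> y \<in> B}"

lemma pairs_commute: "pairs A B = pairs B A"
  unfolding pairs_def by (auto simp: insert_commute)

lemma pairs_subset_all_edges:
  "A \<inter> B = {} \<Longrightarrow> A \<subseteq> V \<Longrightarrow> B \<subseteq> V \<Longrightarrow> pairs A B \<subseteq> all_edges V"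
  by (auto simp: pairs_def all_edges_def card_insert_if)

lemma card_pairs:
  assumes "A \<inter> B = {}"
  shows "card (pairs A B) = card A * card B"
proof -
  have "pairs A B = (\<lambda>(x, y). {x, y}) ` (A \<times> B)" by (auto simp: pairs_def)
  moreover have "inj_on (\<lambda>(x, y). {x, y}) (A \<times> B)"
    using assms by (auto simp: inj_on_def doubleton_eq_iff)
  ultimately show ?thesis by (simp add: card_image card_cartesian_product)
qed

lemma card_ge_if_meets_disjoint:
  assumes "finite S" and meets: "\<And>x. x < k \<Longrightarrow> S \<inter> T x \<noteq> {}"
    and disj: "\<And>x y. x < k \<Longrightarrow> y < k \<Longrightarrow> x \<noteq> y \<Longrightarrow> T x \<inter> T y = {}"
  shows "(k::nat) \<le> card S"
proof -
  define f where "f x = (SOME s. s \<in> S \<inter> T x)" for x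
  have f: "f x \<in> S \<inter> T x" if "x < k" for x
    unfolding f_def some_in_eq using meets[OF that] .
  have "inj_on f {..<k}"
    using f disj by (intro inj_onI) (metis Int_iff disjoint_iff lessThan_iff)
  moreover have "f ` {..<k} \<subseteq> S" using f by auto
  ultimately show ?thesis using card_inj_on_le[of f "{..<k}" S] assms(1) by simp
qed

text \<open>
  A pair \<open>(c, i)\<close> stands for the class with colour \<open>c\<close> in layer \<open>i\<close>; Maker wants matchings between
  adjacent classes.
\<close>

fun adj :: "nat \<times> nat \<Rightarrow> nat \<times> nat \<Rightarrow> bool" where
  "adj (c, i) (c', i') \<longleftrightarrow> (c = c' \<and> (i' = Suc i \<or> i = Suc i')) \<or> (c \<noteq> c' \<and> i = i')"

lemma adj_sym: "adj I J \<longleftrightarrow> adj J I"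
  by (cases I; cases J) auto

lemma adj_irrefl: "\<not> adj I I"
  by (cases I) auto

text \<open>
  The core \<open>U\<close> contains the disjoint parts \<open>P 0, \<dots>, P (k - 1)\<close>, one for each of the \<open>k\<close> edges that
  attach a loose vertex; the other vertices form the classes \<open>C (c, i)\<close>.
\<close>

locale layered_vertices =
  fixes V U :: "'a set" and C :: "nat \<times> nat \<Rightarrow> 'a set" and P :: "nat \<Rightarrow> 'a set"
    and k L q :: nat
  assumes finite_V: "finite V" and U_sub: "U \<subseteq> V" and k_ge: "k \<ge> 2"
    and cover: "V - U = (\<Union>I\<in>{..<k-1} \<times> {..<L}. C I)"
    and C_disj: "\<And>I J. I \<in> {..<k-1} \<times> {..<L} \<Longrightarrow> J \<in> {..<k-1} \<times> {..<L} \<Longrightarrow> I \<noteq> J \<Longrightarrow>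
        C I \<inter> C J = {}"
    and C_card: "\<And>I. I \<in> {..<k-1} \<times> {..<L} \<Longrightarrow> card (C I) = q"
    and P_sub: "\<And>i. i < k \<Longrightarrow> P i \<subseteq> U"
    and P_disj: "\<And>i j. i < k \<Longrightarrow> j < k \<Longrightarrow> i \<noteq> j \<Longrightarrow> P i \<inter> P j = {}"
    and U_card: "2 * k \<le> card U"
begin

abbreviation classes :: "(nat \<times> nat) set" where
  "classes \<equiv> {..<k-1} \<times> {..<L}"

definition unmatched :: "'a set set \<Rightarrow> nat \<times> nat \<Rightarrow> nat \<times> nat \<Rightarrow> 'a set" where
  "unmatched M I J = {x\<in>C I. \<forall>y\<in>C J. {x, y} \<notin> M}"

definition loose :: "'a set set \<Rightarrow> 'a set" where
  "loose M = {x. \<exists>I\<in>classes. x \<in> C I \<and>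
     (snd I = 0 \<or> Suc (snd I) = L \<or> (\<exists>J\<in>classes. adj I J \<and> x \<in> unmatched M I J))}"

lemma finite_U: "finite U"
  using finite_V U_sub finite_subset by blast

lemma C_sub: "I \<in> classes \<Longrightarrow> C I \<subseteq> V - U"
  unfolding cover by blast

lemma finite_C: "I \<in> classes \<Longrightarrow> finite (C I)"
  using C_sub finite_V by (meson finite_Diff finite_subset)

lemma loose_sub: "loose M \<subseteq> V - U"
  unfolding loose_def cover by blast

text \<open>
  Delete a set \<open>S\<close> of fewer than \<open>k\<close> vertices. A vertex \<open>v\<close> that can no longer reach the core
  is not loose, so it has a neighbour in the next and in the previous layer of its colour and one
  in each of the \<open>k - 2\<close> other colours. Each of these \<open>k\<close> neighbours is deleted or cut off from
  the core as well, and following matching edges away from \<open>v\<close> must lead into \<open>S\<close> before the last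
  (or first) layer is reached. So \<open>S\<close> meets \<open>k\<close> pairwise disjoint sets of classes: the higher
  layers of the colour of \<open>v\<close>, its lower layers, and each of the other colours.
\<close>

lemma k_connected_if_hit:
  assumes cuts: "\<And>S A. \<lbrakk>S \<subseteq> U; card S < k; A \<subseteq> U - S; A \<noteq> {}; 2 * card A \<le> card U\<rbrakk> \<Longrightarrow>
      M \<inter> pairs A (U - S - A) \<noteq> {}"
    and attached: "\<And>v i. v \<in> loose M \<Longrightarrow> i < k \<Longrightarrow> M \<inter> pairs {v} (P i) \<noteq> {}"
  shows "k_connected k V M"
  unfolding k_connected_def
proof (intro conjI allI impI, goal_cases)
  case 1
  have "card U \<le> card V" using finite_V U_sub by (rule card_mono)
  then show ?case using U_card k_ge by linarith
next
  case (2 S)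
  then have S: "S \<subseteq> V" "card S < k" by auto
  have finS: "finite S" using S(1) finite_V finite_subset by blast
  define R where "R = {(x, y). x \<in> V - S \<and> y \<in> V - S \<and> {x, y} \<in> {e \<in> M. e \<inter> S = {}}}"
  have R_iff: "(x, y) \<in> R \<longleftrightarrow> x \<in> V - S \<and> y \<in> V - S \<and> {x, y} \<in> M" for x y
    by (auto simp: R_def)
  have "sym R" by (auto simp: sym_def R_iff insert_commute)
  then have sym: "(x, y) \<in> R\<^sup>* \<Longrightarrow> (y, x) \<in> R\<^sup>*" for x y
    by (meson symD sym_rtrancl)
  have "card (S \<inter> U) \<le> card S" using finS by (intro card_mono) auto
  then have SU: "S \<inter> U \<subseteq> U" "card (S \<inter> U) < k" "U - S \<inter> U = U - S" using S by auto
  have core: "(u, u') \<in> R\<^sup>*" if u: "u \<in> U - S" "u' \<in> U - S" for u u'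
  proof (rule ccontr)
    define A where "A = {x\<in>U - S. (u, x) \<in> R\<^sup>*}"
    assume "(u, u') \<notin> R\<^sup>*"
    then have A: "u \<in> A" "u' \<in> U - S - A" "A \<subseteq> U - S" using u by (auto simp: A_def)
    \<comment> \<open>The crossing edge comes from the cut around the smaller of \<open>A\<close> and its complement.\<close>
    have "M \<inter> pairs A (U - S - A) \<noteq> {}"
    proof (cases "2 * card A \<le> card U")
      case True
      then show ?thesis using cuts[of "S \<inter> U" A] SU A by auto
    next
      case False
      have "card A + card (U - S - A) = card (U - S)"
        using A(3) finite_U by (metis card_Diff_subset card_mono finite_Diff finite_subset
            le_add_diff_inverse)
      also have "\<dots> \<le> card U" using finite_U by (intro card_mono) auto
      finally have "2 * card (U - S - A) \<le> card U" using False by linarith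
      moreover have "U - S - (U - S - A) = A" using A(3) by blast
      ultimately show ?thesis
        using cuts[of "S \<inter> U" "U - S - A"] SU A pairs_commute[of A] by auto
    qed
    then obtain x y where "x \<in> A" "y \<in> U - S - A" "{x, y} \<in> M" by (auto simp: pairs_def)
    then have "(u, x) \<in> R\<^sup>*" "(x, y) \<in> R" "(u, y) \<notin> R\<^sup>*"
      using U_sub by (auto simp: A_def R_iff)
    then show False by (meson rtrancl.rtrancl_into_rtrancl)
  qed
  define reaches where "reaches v \<longleftrightarrow> (\<exists>u\<in>U - S. (v, u) \<in> R\<^sup>*)" for v
  have reaches_step: "reaches v" if "(v, w) \<in> R" "reaches w" for v w
    using that unfolding reaches_def by (meson converse_rtrancl_into_rtrancl)
  have loose_reaches: "reaches v" if v: "v \<in> loose M" "v \<notin> S" for v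
  proof (rule ccontr)
    assume nr: "\<not> reaches v"
    have "S \<inter> P i \<noteq> {}" if i: "i < k" for i
    proof -
      obtain u where u: "u \<in> P i" "{v, u} \<in> M" using attached[OF v(1) i] by (auto simp: pairs_def)
      have "u \<in> S"
      proof (rule ccontr)
        assume "u \<notin> S"
        then have "u \<in> U - S" "(v, u) \<in> R"
          using u P_sub[OF i] v loose_sub U_sub by (auto simp: R_iff)
        then show False using nr by (auto simp: reaches_def)
      qed
      then show ?thesis using u by blast
    qed
    then have "k \<le> card S" using P_disj finS by (intro card_ge_if_meets_disjoint[where T = P]) auto
    then show False using S by simp
  qed
  have next_class: "\<exists>w\<in>C J. w \<in> S \<or> \<not> reaches w"
    if v: "v \<in> C I" "I \<in> classes" "v \<notin> S" "\<not> reaches v" "J \<in> classes" "adj I J" for v I J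
  proof -
    have "v \<notin> loose M" using loose_reaches v by blast
    then obtain w where w: "w \<in> C J" "{v, w} \<in> M"
      using v unfolding loose_def unmatched_def by blast
    have "w \<in> S \<or> \<not> reaches w"
    proof (rule ccontr)
      assume "\<not> (w \<in> S \<or> \<not> reaches w)"
      moreover from this have "(v, w) \<in> R"
        using v w C_sub[OF v(2)] C_sub[OF v(5)] by (auto simp: R_iff)
      ultimately show False using reaches_step v by blast
    qed
    then show ?thesis using w by blast
  qed
  have layer: "0 < i \<and> Suc i < L" if "v \<in> C (c, i)" "c < k - 1" "i < L" "v \<notin> S" "\<not> reaches v" for v c i
  proof -
    have "v \<notin> loose M" using loose_reaches that by blast
    moreover have "(c, i) \<in> classes" using that by simp
    ultimately have "i \<noteq> 0 \<and> Suc i \<noteq> L"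
      using that(1) unfolding loose_def mem_Collect_eq by (metis snd_conv)
    then show ?thesis using that by linarith
  qed
  have up: "\<exists>j>i. j < L \<and> S \<inter> C (c, j) \<noteq> {}"
    if "v \<in> C (c, i)" "c < k - 1" "i < L" "v \<notin> S" "\<not> reaches v" for v c i
    using that
  proof (induction "L - i" arbitrary: v i rule: less_induct)
    case less
    have i: "Suc i < L" using layer[OF less.prems] by blast
    then obtain w where w: "w \<in> C (c, Suc i)" "w \<in> S \<or> \<not> reaches w"
      using next_class[of v "(c, i)" "(c, Suc i)"] less.prems by auto
    show ?case
    proof (cases "w \<in> S")
      case True
      then show ?thesis using w i by blast
    next
      case False
      then have "\<exists>j>Suc i. j < L \<and> S \<inter> C (c, j) \<noteq> {}"
        using less.hyps[of "Suc i" w] w i less.prems by auto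
      then show ?thesis using Suc_lessD by blast
    qed
  qed
  have down: "\<exists>j<i. S \<inter> C (c, j) \<noteq> {}"
    if "v \<in> C (c, i)" "c < k - 1" "i < L" "v \<notin> S" "\<not> reaches v" for v c i
    using that
  proof (induction i arbitrary: v)
    case 0
    then show ?case using layer[OF 0] by blast
  next
    case (Suc i)
    then obtain w where w: "w \<in> C (c, i)" "w \<in> S \<or> \<not> reaches w"
      using next_class[of v "(c, Suc i)" "(c, i)"] by auto
    show ?case
    proof (cases "w \<in> S")
      case True
      then show ?thesis using w by blast
    next
      case False
      then have "\<exists>j<i. S \<inter> C (c, j) \<noteq> {}" using Suc.IH[of w] w Suc.prems by auto
      then show ?thesis using less_SucI by blast
    qed
  qed
  have all_reach: "reaches v" if v: "v \<in> V - S" for v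
  proof (rule ccontr)
    assume nr: "\<not> reaches v"
    have "v \<notin> U" using nr v by (auto simp: reaches_def)
    then obtain c i where ci: "c < k - 1" "i < L" "v \<in> C (c, i)" using v cover by blast
    \<comment> \<open>The index \<open>k - 1\<close> is not a colour; it stands for the higher layers of the colour \<open>c\<close>.\<close>
    define N where "N x = (if x = c then {c} \<times> {..<i} else
        if x = k - 1 then {c} \<times> {i<..<L} else {x} \<times> {..<L})" for x
    define T where "T x = (\<Union>I\<in>N x. C I)" for x
    have hit: "S \<inter> T x \<noteq> {}" if "I \<in> N x" "S \<inter> C I \<noteq> {}" for I x
      using that unfolding T_def by blast
    have "S \<inter> T x \<noteq> {}" if "x < k" for x
    proof -
      have "x = k - 1 \<or> x < k - 1" using that by linarith
      then consider "x = c" | "x = k - 1" "x \<noteq> c" | "x \<noteq> c" "x < k - 1" by blast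
      then show ?thesis
      proof cases
        case 1
        have "\<exists>j<i. S \<inter> C (c, j) \<noteq> {}" using down[OF ci(3,1,2)] v nr by blast
        then obtain j where "j < i" "S \<inter> C (c, j) \<noteq> {}" by blast
        then show ?thesis using 1 by (intro hit[of "(c, j)"]) (auto simp: N_def)
      next
        case 2
        have "\<exists>j>i. j < L \<and> S \<inter> C (c, j) \<noteq> {}" using up[OF ci(3,1,2)] v nr by blast
        then obtain j where "j > i" "j < L" "S \<inter> C (c, j) \<noteq> {}" by blast
        then show ?thesis using 2 by (intro hit[of "(c, j)"]) (auto simp: N_def)
      next
        case 3
        obtain w where w: "w \<in> C (x, i)" "w \<in> S \<or> \<not> reaches w"
          using next_class[of v "(c, i)" "(x, i)"] ci 3 v nr by auto
        have "\<exists>j<L. S \<inter> C (x, j) \<noteq> {}"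
        proof (cases "w \<in> S")
          case True
          then show ?thesis using w ci by blast
        next
          case False
          then show ?thesis using up[of w x i] 3 ci w by blast
        qed
        then obtain j where "j < L" "S \<inter> C (x, j) \<noteq> {}" by blast
        then show ?thesis using 3 by (intro hit[of "(x, j)"]) (auto simp: N_def)
      qed
    qed
    moreover have "T x \<inter> T y = {}" if "x < k" "y < k" "x \<noteq> y" for x y
    proof -
      have "N x \<subseteq> classes" "N y \<subseteq> classes" "N x \<inter> N y = {}"
        using that ci by (auto simp: N_def split: if_splits)
      then show ?thesis unfolding T_def using C_disj by fast
    qed
    ultimately have "k \<le> card S"
      using finS by (intro card_ge_if_meets_disjoint[where T = T]) auto
    then show False using S by simp
  qed
  have "card (S \<inter> U) < card U" using SU U_card by linarith
  then have "S \<inter> U \<noteq> U" by auto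
  then have "U - S \<noteq> {}" by blast
  then have ne: "V - S \<noteq> {}" using U_sub by blast
  have "(v, w) \<in> R\<^sup>*" if vw: "v \<in> V - S" "w \<in> V - S" for v w
  proof -
    obtain x where "x \<in> U - S" "(v, x) \<in> R\<^sup>*"
      using all_reach[OF vw(1)] unfolding reaches_def by blast
    moreover obtain y where "y \<in> U - S" "(w, y) \<in> R\<^sup>*"
      using all_reach[OF vw(2)] unfolding reaches_def by blast
    ultimately show ?thesis using core[of x y] sym[of w y] by (meson rtrancl_trans)
  qed
  then show ?case unfolding connected_graph_def R_def[symmetric] using ne by blast
qed

end

section \<open>Maker's strategy on a fixed graph\<close>

(* From here on adjacency matters only through its symmetry, irreflexivity and bounded degree. *)
declare adj.simps [simp del]

context layered_vertices
begin

text \<open>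
  The cuts of the core that \<open>k\<close>-connectivity must cross: \<open>S\<close> is deleted and \<open>A\<close> is the smaller side.
\<close>

definition cut_choices :: "('a set \<times> 'a set) set" where
  "cut_choices = {(S, A). S \<subseteq> U \<and> card S < k \<and> A \<subseteq> U - S \<and> A \<noteq> {} \<and> 2 * card A \<le> card U}"

lemma finite_cut_choices: "finite cut_choices"
proof -
  have "cut_choices \<subseteq> Pow U \<times> Pow U" by (auto simp: cut_choices_def)
  then show ?thesis using finite_U by (meson finite_Pow_iff finite_SigmaI finite_subset)
qed

lemma class_unique: "x \<in> C I \<Longrightarrow> x \<in> C J \<Longrightarrow> I \<in> classes \<Longrightarrow> J \<in> classes \<Longrightarrow> I = J"
  using C_disj by blast

definition matched :: "'a set set \<Rightarrow> bool" where
  "matched M \<longleftrightarrow> (\<forall>I\<in>classes. \<forall>J\<in>classes. adj I J \<longrightarrow>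
     (\<forall>x\<in>C I. \<forall>y\<in>C J. \<forall>y'\<in>C J. {x, y} \<in> M \<longrightarrow> {x, y'} \<in> M \<longrightarrow> y = y'))"

lemma matchedD:
  "\<lbrakk>matched M; I \<in> classes; J \<in> classes; adj I J; x \<in> C I; y \<in> C J; y' \<in> C J; {x, y} \<in> M; {x, y'} \<in> M\<rbrakk>
    \<Longrightarrow> y = y'"
  unfolding matched_def by blast

lemma matched_insert:
  assumes M: "matched M" and IJ: "I \<in> classes" "J \<in> classes" "adj I J"
    and x: "x \<in> unmatched M I J" and y: "y \<in> unmatched M J I"
  shows "matched (insert {x, y} M)"
  unfolding matched_def
proof (intro ballI impI)
  fix I' J' x' y1 y2
  assume a: "I' \<in> classes" "J' \<in> classes" "adj I' J'" "x' \<in> C I'" "y1 \<in> C J'" "y2 \<in> C J'"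
    and e: "{x', y1} \<in> insert {x, y} M" "{x', y2} \<in> insert {x, y} M"
  have new: False if n: "{x', z} = {x, y}" "{x', z'} \<in> M" "z \<in> C J'" "z' \<in> C J'" for z z'
  proof -
    have xI: "x \<in> C I" "y \<in> C J" using x y by (auto simp: unmatched_def)
    consider "x' = x" "z = y" | "x' = y" "z = x" using n(1) by (auto simp: doubleton_eq_iff)
    then show False
    proof cases
      case 1
      then have "J' = J" using class_unique[of y J' J] a IJ xI n by blast
      then show False using x n 1 by (auto simp: unmatched_def)
    next
      case 2
      then have "J' = I" using class_unique[of x J' I] a IJ xI n by blast
      then show False using y n 2 by (auto simp: unmatched_def)
    qed
  qed
  show "y1 = y2"
  proof (cases "{x', y1} \<in> M")
    case True
    show ?thesis
    proof (cases "{x', y2} \<in> M")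
      case True
      then show ?thesis using \<open>{x', y1} \<in> M\<close> matchedD[OF M a(1,2,3,4,5,6)] by blast
    next
      case False
      then show ?thesis using new[of y2 y1] True a e by blast
    qed
  next
    case False
    show ?thesis
    proof (cases "{x', y2} \<in> M")
      case True
      then show ?thesis using new[of y1 y2] False a e by blast
    next
      case F2: False
      have "{x', y1} = {x', y2}" using False F2 e by blast
      then show ?thesis by (auto simp: doubleton_eq_iff)
    qed
  qed
qed

lemma unmatched_mono: "M \<subseteq> M' \<Longrightarrow> unmatched M' I J \<subseteq> unmatched M I J"
  unfolding unmatched_def by blast

text \<open>
  Moves in the core or between a vertex and the core do not change which vertices are loose. So
  once the matchings are maximal, the set of vertices to be attached stays fixed.
\<close>

lemma loose_insert_outside:
  assumes "\<not> e \<subseteq> V - U"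
  shows "loose (insert e M) = loose M"
proof -
  have "unmatched (insert e M) I J = unmatched M I J" if "I \<in> classes" "J \<in> classes" for I J
  proof -
    have "{x, y} \<noteq> e" if "x \<in> C I" "y \<in> C J" for x y
      using C_sub[OF \<open>I \<in> classes\<close>] C_sub[OF \<open>J \<in> classes\<close>] that assms by blast
    then show ?thesis by (auto simp: unmatched_def)
  qed
  then show ?thesis unfolding loose_def by blast
qed

text \<open>
  The classes have equal size and Maker's edges between two of them form a matching. Applied in both
  directions, this gives equality: if one side has many unmatched vertices, so has the other.
\<close>

lemma card_unmatched_le:
  assumes M: "matched M" and IJ: "I \<in> classes" "J \<in> classes" "adj I J"
  shows "card (unmatched M J I) \<le> card (unmatched M I J)"
proof -
  define f where "f x = (SOME y. y \<in> C J \<and> {x, y} \<in> M)" for x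
  have f: "f x \<in> C J \<and> {x, f x} \<in> M" if "x \<in> C I - unmatched M I J" for x
  proof -
    have "\<exists>y. y \<in> C J \<and> {x, y} \<in> M" using that by (auto simp: unmatched_def)
    from someI_ex[OF this] show ?thesis by (simp add: f_def)
  qed
  have "inj_on f (C I - unmatched M I J)"
  proof (rule inj_onI)
    fix x x' assume x: "x \<in> C I - unmatched M I J" "x' \<in> C I - unmatched M I J" "f x = f x'"
    then have "{f x, x} \<in> M" "{f x, x'} \<in> M" "f x \<in> C J"
      using f[OF x(1)] f[OF x(2)] by (simp_all add: insert_commute)
    then show "x = x'"
      using x IJ adj_sym[of I J] by (intro matchedD[OF M IJ(2,1), of "f x"]) simp_all
  qed
  moreover have "f ` (C I - unmatched M I J) \<subseteq> C J - unmatched M J I"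
  proof (rule image_subsetI)
    fix x assume x: "x \<in> C I - unmatched M I J"
    then have "{f x, x} \<in> M" "f x \<in> C J" using f[OF x] by (simp_all add: insert_commute)
    then show "f x \<in> C J - unmatched M J I" using x unfolding unmatched_def by blast
  qed
  ultimately have "card (C I - unmatched M I J) \<le> card (C J - unmatched M J I)"
    using finite_C[OF IJ(2)] by (intro card_inj_on_le) auto
  moreover have "unmatched M I J \<subseteq> C I" "unmatched M J I \<subseteq> C J" by (auto simp: unmatched_def)
  ultimately show ?thesis
    using finite_C[OF IJ(1)] finite_C[OF IJ(2)] C_card[OF IJ(1)] C_card[OF IJ(2)]
    by (metis (no_types, lifting) card_Diff_subset card_mono diff_le_mono2 diff_diff_cancel
        finite_subset)
qed

lemma card_adj_le:
  assumes "I \<in> classes"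
  shows "card {J\<in>classes. adj I J} \<le> k"
proof -
  obtain c i where I: "I = (c, i)" "c < k - 1" using assms by auto
  have "{J\<in>classes. adj I J} \<subseteq> insert (c, Suc i) (insert (c, i - 1) ((\<lambda>c'. (c', i)) ` ({..<k-1} - {c})))"
    by (auto simp: I adj.simps)
  then have "card {J\<in>classes. adj I J} \<le>
      card (insert (c, Suc i) (insert (c, i - 1) ((\<lambda>c'. (c', i)) ` ({..<k-1} - {c}))))"
    by (intro card_mono) auto
  also have "\<dots> \<le> Suc (Suc (card ((\<lambda>c'. (c', i)) ` ({..<k-1} - {c}))))"
    by (intro card_insert_le_m1[THEN order_trans] card_insert_le) (auto simp: card_insert_if)
  also have "\<dots> \<le> Suc (Suc (card ({..<k-1} - {c})))"
    using card_image_le[of "{..<k-1} - {c}" "\<lambda>c'. (c', i)"] by simp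
  also have "\<dots> \<le> k" using I k_ge by simp
  finally show ?thesis .
qed

definition class_edges :: "'a set set" where
  "class_edges = (\<Union>(I, J)\<in>{(I, J). I \<in> classes \<and> J \<in> classes \<and> adj I J}. pairs (C I) (C J))"

lemma class_edgesE:
  assumes "e \<in> class_edges"
  obtains I J x y where "I \<in> classes" "J \<in> classes" "adj I J" "x \<in> C I" "y \<in> C J" "e = {x, y}"
  using assms unfolding class_edges_def pairs_def by blast

text \<open>
  Count pairs of an edge and one of its ends: such a pair is determined by the end and the class
  of the other end, and every class is adjacent to at most \<open>k\<close> others.
\<close>

lemma card_matching_edges:
  assumes M: "matched M"
  shows "2 * card (M \<inter> class_edges) \<le> k * card (V - U)"
proof -
  define cl where "cl x = (THE I. I \<in> classes \<and> x \<in> C I)" for x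
  have cl: "cl x = I" if "x \<in> C I" "I \<in> classes" for x I
    unfolding cl_def by (rule the_equality) (use that class_unique[of x] in auto)
  define N where "N = M \<inter> class_edges"
  have edge: "\<exists>J y. J \<in> classes \<and> adj (cl x) J \<and> x \<in> C (cl x) \<and> cl x \<in> classes \<and> y \<in> C J \<and> e = {x, y}"
    if e: "e \<in> N" "x \<in> e" for e x
  proof -
    have "e \<in> class_edges" using e by (simp add: N_def)
    then obtain I J a c where *: "I \<in> classes" "J \<in> classes" "adj I J" "a \<in> C I" "c \<in> C J" "e = {a, c}"
      by (rule class_edgesE)
    from e * consider "x = a" | "x = c" by blast
    then show ?thesis
    proof cases
      case 1
      then show ?thesis
        using * cl[OF *(4,1)] by (intro exI[of _ J] exI[of _ c]) simp
    next
      case 2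
      then have "cl x = J" "adj J I" "e = {x, a}" "x \<in> C J"
        using * cl[OF *(5,2)] adj_sym[of I J] by auto
      then show ?thesis using * by (intro exI[of _ I] exI[of _ a]) simp
    qed
  qed
  define g where "g = (\<lambda>(e, x). SOME J. J \<in> classes \<and> adj (cl x) J \<and> (\<exists>y\<in>C J. e = {x, y}))"
  have g: "g (e, x) \<in> classes \<and> adj (cl x) (g (e, x)) \<and> (\<exists>y\<in>C (g (e, x)). e = {x, y})"
    if "e \<in> N" "x \<in> e" for e x
  proof -
    have "\<exists>J. J \<in> classes \<and> adj (cl x) J \<and> (\<exists>y\<in>C J. e = {x, y})" using edge[OF that] by blast
    from someI_ex[OF this] show ?thesis by (simp add: g_def)
  qed
  have fin: "finite N"
  proof -
    have "N \<subseteq> Pow V"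
    proof
      fix e assume "e \<in> N"
      then have "e \<in> class_edges" by (simp add: N_def)
      then obtain I J a c where "I \<in> classes" "J \<in> classes" "a \<in> C I" "c \<in> C J" "e = {a, c}"
        by (rule class_edgesE)
      then show "e \<in> Pow V" using C_sub[of I] C_sub[of J] by blast
    qed
    then show ?thesis using finite_V finite_subset by blast
  qed
  have two: "card e = 2" if "e \<in> N" for e
  proof -
    have "e \<in> class_edges" using that by (simp add: N_def)
    then obtain I J a c where *: "I \<in> classes" "J \<in> classes" "adj I J" "a \<in> C I" "c \<in> C J" "e = {a, c}"
      by (rule class_edgesE)
    then have "a \<noteq> c" using class_unique[of a I J] adj_irrefl[of I] by blast
    then show ?thesis using * by simp
  qed
  have "card (Sigma N (\<lambda>e. e)) = (\<Sum>e\<in>N. card e)"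
    using fin two by (intro card_SigmaI) (auto intro: card_ge_0_finite)
  also have "\<dots> = 2 * card N" using two by simp
  finally have "2 * card N = card (Sigma N (\<lambda>e. e))" ..
  also have "\<dots> \<le> card (Sigma (V - U) (\<lambda>x. {J\<in>classes. adj (cl x) J}))"
  proof (rule card_inj_on_le[of "\<lambda>p. (snd p, g p)"])
    show "finite (Sigma (V - U) (\<lambda>x. {J\<in>classes. adj (cl x) J}))" using finite_V by auto
    show "(\<lambda>p. (snd p, g p)) ` Sigma N (\<lambda>e. e) \<subseteq> Sigma (V - U) (\<lambda>x. {J\<in>classes. adj (cl x) J})"
    proof clarsimp
      fix e x assume "e \<in> N" "x \<in> e"
      then show "x \<in> V \<and> x \<notin> U \<and> g (e, x) \<in> {..<k - Suc 0} \<times> {..<L} \<and> adj (cl x) (g (e, x))"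
        using g[of e x] edge[of e x] C_sub[of "cl x"] by auto
    qed
    show "inj_on (\<lambda>p. (snd p, g p)) (Sigma N (\<lambda>e. e))"
    proof (rule inj_onI, clarsimp)
      fix e e' x assume e: "e \<in> N" "x \<in> e" "e' \<in> N" "x \<in> e'" "g (e, x) = g (e', x)"
      obtain y where y: "y \<in> C (g (e, x))" "e = {x, y}" using g[OF e(1,2)] by blast
      obtain y' where y': "y' \<in> C (g (e, x))" "e' = {x, y'}" using g[OF e(3,4)] e(5) by auto
      have "x \<in> C (cl x)" "cl x \<in> classes" using edge[OF e(1,2)] by blast+
      moreover have "{x, y} \<in> M" "{x, y'} \<in> M" using e y y' by (auto simp: N_def)
      moreover have gJ: "g (e, x) \<in> classes" "adj (cl x) (g (e, x))" using g[OF e(1,2)] by blast+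
      ultimately have "y = y'" by (intro matchedD[OF M _ gJ _ y(1) y'(1)])
      then show "e = e'" using y y' by simp
    qed
  qed
  also have "\<dots> = (\<Sum>x\<in>V - U. card {J\<in>classes. adj (cl x) J})"
    using finite_V by (intro card_SigmaI) auto
  also have "\<dots> \<le> (\<Sum>x\<in>V - U. k)"
  proof (intro sum_mono card_adj_le)
    fix x assume "x \<in> V - U"
    then obtain I where "I \<in> classes" "x \<in> C I" using cover by blast
    then show "cl x \<in> classes" using cl by simp
  qed
  finally show ?thesis by (simp add: N_def mult.commute)
qed

lemma card_loose_le:
  assumes small: "\<And>I J. I \<in> classes \<Longrightarrow> J \<in> classes \<Longrightarrow> adj I J \<Longrightarrow> card (unmatched M I J) \<le> s"
    and "L \<ge> 1"
  shows "card (loose M) \<le> 2 * (k - 1) * q + ((k - 1) * L)\<^sup>2 * s"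
proof -
  define Q where "Q = {(I, J). I \<in> classes \<and> J \<in> classes \<and> adj I J}"
  define Z where "Z = {..<k-1} \<times> {0, L - 1}"
  have Q: "Q \<subseteq> classes \<times> classes" by (auto simp: Q_def)
  have finQ: "finite Q" using Q finite_subset by blast
  have Z: "Z \<subseteq> classes" using assms(2) by (auto simp: Z_def)
  have "loose M \<subseteq> (\<Union>I\<in>Z. C I) \<union> (\<Union>(I, J)\<in>Q. unmatched M I J)"
  proof
    fix x assume "x \<in> loose M"
    then obtain I where I: "I \<in> classes" "x \<in> C I"
      "snd I = 0 \<or> Suc (snd I) = L \<or> (\<exists>J\<in>classes. adj I J \<and> x \<in> unmatched M I J)"
      unfolding loose_def by blast
    then show "x \<in> (\<Union>I\<in>Z. C I) \<union> (\<Union>(I, J)\<in>Q. unmatched M I J)"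
    proof (cases "\<exists>J\<in>classes. adj I J \<and> x \<in> unmatched M I J")
      case True
      then show ?thesis using I by (auto simp: Q_def)
    next
      case False
      then have "I \<in> Z" using I by (cases I) (auto simp: Z_def)
      then show ?thesis using I by blast
    qed
  qed
  then have "card (loose M) \<le> card ((\<Union>I\<in>Z. C I) \<union> (\<Union>(I, J)\<in>Q. unmatched M I J))"
  proof (intro card_mono)
    have "(\<Union>I\<in>Z. C I) \<union> (\<Union>(I, J)\<in>Q. unmatched M I J) \<subseteq> (\<Union>I\<in>classes. C I)"
      using Z Q by (auto simp: unmatched_def)
    then show "finite ((\<Union>I\<in>Z. C I) \<union> (\<Union>(I, J)\<in>Q. unmatched M I J))"
      using finite_V unfolding cover[symmetric] by (meson finite_Diff finite_subset)
  qed
  also have "\<dots> \<le> card (\<Union>I\<in>Z. C I) + card (\<Union>(I, J)\<in>Q. unmatched M I J)"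
    by (rule card_Un_le)
  also have "\<dots> \<le> (\<Sum>I\<in>Z. card (C I)) + (\<Sum>p\<in>Q. card (case p of (I, J) \<Rightarrow> unmatched M I J))"
    using finQ by (intro add_mono card_UN_le) (auto simp: Z_def)
  also have "\<dots> \<le> (\<Sum>I\<in>Z. q) + (\<Sum>p\<in>Q. s)"
    using C_card Z small by (intro add_mono sum_mono) (auto simp: Q_def)
  also have "\<dots> = card Z * q + card Q * s" by simp
  also have "\<dots> \<le> 2 * (k - 1) * q + ((k - 1) * L)\<^sup>2 * s"
  proof (intro add_mono mult_right_mono)
    show "card Z \<le> 2 * (k - 1)"
      unfolding Z_def card_cartesian_product by (simp add: card_insert_if)
    have "card Q \<le> card (classes \<times> classes)" using Q by (intro card_mono) auto
    then show "card Q \<le> ((k - 1) * L)\<^sup>2"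
      by (simp only: card_cartesian_product card_lessThan power2_eq_square)
  qed auto
  finally show ?thesis .
qed

end

text \<open>
  The edge distribution under which Maker's strategy works. The sum of the initial dangers is less
  than \<open>1\<close>. Between any two disjoint sets of at least \<open>s\<close> vertices outside the core there are more edges than
  are claimed in the first \<open>2 k n\<close> rounds. The four summands below \<open>t\<close> bound the number of Maker's edges in the core, in
  the matchings, in sets where Breaker became dangerous, and at loose vertices.
\<close>

locale game_board = layered_vertices V U C P k L q
  for V U :: "'a set" and C :: "nat \<times> nat \<Rightarrow> 'a set" and P :: "nat \<Rightarrow> 'a set" and k L q :: nat +
  fixes E :: "'a set set" and b \<tau> s :: nat and t :: real
  assumes E_sub: "E \<subseteq> all_edges V" and b_ge: "b \<ge> 1" and \<tau>_ge: "\<tau> \<ge> 1" and L_ge: "L \<ge> 1"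
    and initial_danger:
      "(\<Sum>(S, A)\<in>cut_choices. 2 powr (1 - real (card (E \<inter> pairs A (U - S - A))) / real b)) +
       (\<Sum>(v, i)\<in>(V - U) \<times> {..<k}. 2 powr (1 + (real \<tau> - real (card (E \<inter> pairs {v} (P i)))) / real b)) < 1"
    and spread: "\<And>A B. \<lbrakk>A \<subseteq> V - U; B \<subseteq> V - U; A \<inter> B = {}; s \<le> card A; s \<le> card B\<rbrakk> \<Longrightarrow>
      (b + 1) * (2 * k * card V) < card (E \<inter> pairs A B)"
    and t_ge: "real (card (E \<inter> all_edges U)) + real k * real (card V) / 2 +
        real b * (2 * real k * real (card V)) / real \<tau> +
        real k * real (2 * (k - 1) * q + ((k - 1) * L)\<^sup>2 * s) \<le> t"
    and t_le: "t \<le> 2 * real k * real (card V) - 1"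
begin

definition spokes :: "'a \<Rightarrow> nat \<Rightarrow> 'a set set" where
  "spokes v i = E \<inter> pairs {v} (P i)"

definition cut :: "'a set \<Rightarrow> 'a set \<Rightarrow> 'a set set" where
  "cut S A = E \<inter> pairs A (U - S - A)"

definition targets :: "'a set set set" where
  "targets = (\<lambda>(S, A). cut S A) ` cut_choices \<union> (\<lambda>(v, i). spokes v i) ` ((V - U) \<times> {..<k})"

text \<open>
  Cuts must be watched from the start; there are few core edges to be spent on them. The edges from a
  vertex to a part are watched only from the \<open>\<tau>\<close>-th one that Breaker owns, as there are too many vertices
  to attach all of them.
\<close>

definition tolerance :: "'a set set \<Rightarrow> nat" where
  "tolerance F = (if F \<subseteq> all_edges U then 0 else \<tau>)"

lemma finite_E: "finite E"
proof -
  have "E \<subseteq> Pow V" using E_sub by (auto simp: all_edges_def)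
  then show ?thesis using finite_V by (meson finite_Pow_iff finite_subset)
qed

sublocale hitting_game targets tolerance b
proof
  show "finite targets" using finite_cut_choices finite_V by (auto simp: targets_def)
  show "finite F" if "F \<in> targets" for F
    using that finite_E by (auto simp: targets_def spokes_def cut_def)
qed (rule b_ge)

lemma cut_target: "(S, A) \<in> cut_choices \<Longrightarrow> cut S A \<in> targets"
  unfolding targets_def by force

lemma spokes_target: "v \<in> V - U \<Longrightarrow> i < k \<Longrightarrow> spokes v i \<in> targets"
  unfolding targets_def by force

lemma cut_inside: "(S, A) \<in> cut_choices \<Longrightarrow> cut S A \<subseteq> all_edges U"
proof -
  assume "(S, A) \<in> cut_choices"
  then have "A \<subseteq> U" by (auto simp: cut_choices_def)
  then have "pairs A (U - S - A) \<subseteq> all_edges U" by (intro pairs_subset_all_edges) auto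
  then show ?thesis by (auto simp: cut_def)
qed

lemma spokesE:
  assumes "e \<in> spokes v i" "i < k"
  obtains u where "u \<in> P i" "u \<in> U" "e = {v, u}" "e \<in> E"
  using assms P_sub[OF assms(2)] unfolding spokes_def pairs_def by blast

text \<open>
  So attaching a vertex to the core changes neither Maker's graph in the core nor his matchings.
\<close>

lemma spokes_crosses:
  assumes "v \<in> V - U" "i < k" "e \<in> spokes v i"
  shows "e \<notin> all_edges U" "\<not> e \<subseteq> V - U"
  using assms by (auto elim!: spokesE simp: all_edges_def)

lemma core_edge_not_outside:
  assumes "e \<in> all_edges U"
  shows "\<not> e \<subseteq> V - U"
proof
  assume "e \<subseteq> V - U"
  then have "e = {}" using assms by (auto simp: all_edges_def)
  then show False using assms by (simp add: all_edges_def)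
qed

lemma spokes_disjoint:
  assumes "v \<in> V - U" "i < k" "w \<in> V - U" "j < k" "e \<in> spokes v i" "e \<in> spokes w j"
  shows "v = w \<and> i = j"
proof -
  obtain u where u: "u \<in> P i" "u \<in> U" "e = {v, u}" using assms(5,2) by (rule spokesE)
  obtain u' where u': "u' \<in> P j" "u' \<in> U" "e = {w, u'}" using assms(6,4) by (rule spokesE)
  have "{v, u} = {w, u'}" using u u' by simp
  then have "v = w" "u = u'" using assms u u' by (auto simp: doubleton_eq_iff)
  then show ?thesis using P_disj[OF assms(2,4)] u u' by blast
qed

lemma total_danger_empty: "total_danger {} {} < 1"
proof -
  let ?c = "\<lambda>(S, A). cut S A" and ?x = "\<lambda>(v, i). spokes v i"
  have "total_danger {} {} = (\<Sum>F\<in>targets. danger {} F)" by (simp add: total_danger_def)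
  also have "\<dots> \<le> (\<Sum>F\<in>?c ` cut_choices. danger {} F) + (\<Sum>F\<in>?x ` ((V - U) \<times> {..<k}). danger {} F)"
    unfolding targets_def using finite_cut_choices finite_V
    by (subst sum.union_inter[symmetric]) (auto intro!: sum_nonneg danger_nonneg)
  also have "(\<Sum>F\<in>?c ` cut_choices. danger {} F) \<le> (\<Sum>p\<in>cut_choices. danger {} (?c p))"
    using sum_image_le[of cut_choices "danger {}" ?c] finite_cut_choices
    by (simp add: danger_nonneg o_def)
  also have "\<dots> = (\<Sum>(S, A)\<in>cut_choices. 2 powr (1 - real (card (E \<inter> pairs A (U - S - A))) / real b))"
  proof (intro sum.cong refl)
    fix p assume p: "p \<in> cut_choices"
    obtain S A where SA: "p = (S, A)" by force
    have "tolerance (cut S A) = 0" using cut_inside p SA by (auto simp: tolerance_def)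
    then show "danger {} (?c p) =
        (case p of (S, A) \<Rightarrow> 2 powr (1 - real (card (E \<inter> pairs A (U - S - A))) / real b))"
      using b_ge by (simp add: danger_def SA cut_def diff_divide_distrib)
  qed
  also have "(\<Sum>F\<in>?x ` ((V - U) \<times> {..<k}). danger {} F) \<le> (\<Sum>p\<in>(V - U) \<times> {..<k}. danger {} (?x p))"
    using sum_image_le[of "(V - U) \<times> {..<k}" "danger {}" ?x] finite_V
    by (simp add: danger_nonneg o_def)
  also have "\<dots> \<le> (\<Sum>(v, i)\<in>(V - U) \<times> {..<k}.
      2 powr (1 + (real \<tau> - real (card (E \<inter> pairs {v} (P i)))) / real b))"
  proof (intro sum_mono)
    fix p assume "p \<in> (V - U) \<times> {..<k}"
    obtain v i where vi: "p = (v, i)" by force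
    have "danger {} (spokes v i) \<le> 2 powr ((real \<tau> + real b - real (card (spokes v i))) / real b)"
      unfolding danger_def by (intro powr_mono divide_right_mono) (auto simp: tolerance_def)
    also have "(real \<tau> + real b - real (card (spokes v i))) / real b =
        1 + (real \<tau> - real (card (E \<inter> pairs {v} (P i)))) / real b"
      using b_ge by (simp add: field_simps spokes_def)
    finally show "danger {} (?x p) \<le> (case p of (v, i) \<Rightarrow>
        2 powr (1 + (real \<tau> - real (card (E \<inter> pairs {v} (P i)))) / real b))"
      by (simp add: vi)
  qed
  finally show ?thesis using initial_danger by linarith
qed

definition available :: "'a set set \<Rightarrow> 'a set set \<Rightarrow> 'a set \<Rightarrow> bool" where
  "available M B e \<longleftrightarrow> e \<in> E - (M \<union> B) \<and> (\<exists>I\<in>classes. \<exists>J\<in>classes. adj I J \<and>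
     e \<in> pairs (unmatched M I J) (unmatched M J I))"

lemma available_anti_mono:
  assumes "available M' B' e" "M \<subseteq> M'" "B \<subseteq> B'"
  shows "available M B e"
proof -
  obtain I J where IJ: "I \<in> classes" "J \<in> classes" "adj I J"
    "e \<in> pairs (unmatched M' I J) (unmatched M' J I)" "e \<in> E - (M' \<union> B')"
    using assms(1) unfolding available_def by blast
  have "e \<in> pairs (unmatched M I J) (unmatched M J I)"
    using IJ(4) unmatched_mono[OF assms(2)] unfolding pairs_def by blast
  then show ?thesis using IJ assms unfolding available_def by blast
qed

lemma available_class_edge:
  assumes "available M B e"
  shows "e \<in> class_edges" "e \<subseteq> V - U" "e \<notin> all_edges U"
proof -
  obtain I J x y where IJ: "I \<in> classes" "J \<in> classes" "adj I J"
    "x \<in> unmatched M I J" "y \<in> unmatched M J I" "e = {x, y}"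
    using assms unfolding available_def pairs_def by blast
  then have xy: "x \<in> C I" "y \<in> C J" by (auto simp: unmatched_def)
  then show "e \<in> class_edges" using IJ unfolding class_edges_def pairs_def by blast
  show "e \<subseteq> V - U" using xy IJ C_sub[of I] C_sub[of J] by blast
  then show "e \<notin> all_edges U" using IJ(6) by (auto simp: all_edges_def)
qed

text \<open>
  Maker always plays an edge of largest urgency. If that urgency is positive, the edge lies in the core
  or in a set that Breaker has made dangerous. Otherwise Maker is free to extend a matching, and when
  no matching can be extended he attaches loose vertices.
\<close>

definition good_move :: "'a set set \<Rightarrow> 'a set set \<Rightarrow> 'a set \<Rightarrow> bool" where
  "good_move M B e \<longleftrightarrow> e \<in> E - (M \<union> B) \<and>
     (\<forall>e'\<in>E - (M \<union> B). urgency M B e' \<le> urgency M B e) \<and>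
     (e \<in> all_edges U \<or> available M B e \<or>
      (\<exists>v\<in>V - U. \<exists>i<k. e \<in> spokes v i \<and> M \<inter> spokes v i = {} \<and>
        (\<tau> \<le> card (B \<inter> spokes v i) \<or> (v \<in> loose M \<and> \<not> (\<exists>e. available M B e)))))"

lemma good_moveI:
  assumes "e \<in> E - (M \<union> B)" "\<forall>e'\<in>E - (M \<union> B). urgency M B e' \<le> urgency M B e"
    and "e \<in> all_edges U \<or> available M B e \<or>
      (\<exists>v\<in>V - U. \<exists>i<k. e \<in> spokes v i \<and> M \<inter> spokes v i = {} \<and>
        (\<tau> \<le> card (B \<inter> spokes v i) \<or> (v \<in> loose M \<and> \<not> (\<exists>e. available M B e))))"
  shows "\<exists>e. good_move M B e"
  using assms unfolding good_move_def by (intro exI[of _ e]) simp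

text \<open>
  If all urgencies vanish, then every cut is hit, since an unhit cut contains a free edge. If in
  addition no matching can be extended and Maker has not won, then some loose vertex is not yet
  attached to some part, and Breaker has not claimed all edges between them.
\<close>

lemma good_move_exists:
  assumes danger: "total_danger M B < 1" and not_won: "\<not> k_connected k V M"
  shows "\<exists>e. good_move M B e"
proof (cases "\<exists>e\<in>E - (M \<union> B). urgency M B e > 0")
  case True
  define Z where "Z = urgency M B ` (E - (M \<union> B))"
  have finZ: "finite Z" using finite_E by (simp add: Z_def)
  obtain e0 where e0: "e0 \<in> E - (M \<union> B)" "urgency M B e0 > 0" using True by blast
  then have "Z \<noteq> {}" unfolding Z_def by blast
  then have "Max Z \<in> Z" by (rule Max_in[OF finZ])
  then obtain e where e: "e \<in> E - (M \<union> B)" "urgency M B e = Max Z"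
    unfolding Z_def image_iff by metis
  have max: "\<forall>e'\<in>E - (M \<union> B). urgency M B e' \<le> urgency M B e"
  proof
    fix e' assume "e' \<in> E - (M \<union> B)"
    then have "urgency M B e' \<in> Z" unfolding Z_def by (rule imageI)
    then show "urgency M B e' \<le> urgency M B e" unfolding e(2) by (rule Max_ge[OF finZ])
  qed
  then have "urgency M B e > 0" using e0 by (meson less_le_trans)
  then obtain F where F: "F \<in> targets" "e \<in> F" "F \<inter> M = {}" "tolerance F \<le> card (F \<inter> B)"
    unfolding urgency_pos_iff by blast
  from F(1) consider (cut) S A where "(S, A) \<in> cut_choices" "F = cut S A"
    | (spokes) v i where "v \<in> V - U" "i < k" "F = spokes v i"
    unfolding targets_def by (elim UnE imageE) auto
  then show ?thesis
  proof cases
    case cut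
    then have "e \<in> all_edges U" using cut_inside F(2) by blast
    then show ?thesis using e by (intro good_moveI[of e] max) simp_all
  next
    case spokes
    then have "\<not> F \<subseteq> all_edges U" using spokes_crosses F(2) by blast
    then have "\<tau> \<le> card (B \<inter> spokes v i)" "M \<inter> spokes v i = {}"
      using F spokes by (auto simp: tolerance_def Int_commute)
    then show ?thesis using e spokes F(2) by (intro good_moveI[of e] max) auto
  qed
next
  case False
  have nn: "urgency M B e \<ge> 0" for e
    unfolding urgency_def by (intro sum_nonneg danger_nonneg)
  have max: "\<forall>e'\<in>E - (M \<union> B). urgency M B e' \<le> urgency M B e" for e
  proof
    fix e' assume "e' \<in> E - (M \<union> B)"
    then have "urgency M B e' \<le> 0" using False by (meson not_less)
    then show "urgency M B e' \<le> urgency M B e" using nn[of e] by linarith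
  qed
  show ?thesis
  proof (cases "\<exists>e. available M B e")
    case True
    then obtain e where e: "available M B e" by blast
    then have "e \<in> E - (M \<union> B)" unfolding available_def by (rule conjunct1)
    then show ?thesis using e by (intro good_moveI[of e] max) simp_all
  next
    case no_avail: False
    have cuts: "M \<inter> pairs A (U - S - A) \<noteq> {}"
      if c: "S \<subseteq> U" "card S < k" "A \<subseteq> U - S" "A \<noteq> {}" "2 * card A \<le> card U" for S A
    proof
      assume empty: "M \<inter> pairs A (U - S - A) = {}"
      have SA: "(S, A) \<in> cut_choices" using c by (simp add: cut_choices_def)
      have unhit: "cut S A \<inter> M = {}" using empty by (auto simp: cut_def)
      then obtain e where e: "e \<in> cut S A" "e \<notin> B"
        using not_filled[OF danger cut_target[OF SA]] by blast
      have "tolerance (cut S A) = 0" using cut_inside[OF SA] by (simp add: tolerance_def)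
      then have "urgency M B e > 0"
        unfolding urgency_pos_iff using cut_target[OF SA] e unhit by (intro bexI[of _ "cut S A"]) auto
      moreover have "e \<in> E - (M \<union> B)" using e unhit by (auto simp: cut_def)
      ultimately show False using False by blast
    qed
    obtain v i where vi: "v \<in> loose M" "i < k" "M \<inter> pairs {v} (P i) = {}"
      using k_connected_if_hit[of M, OF cuts] not_won by blast
    have v: "v \<in> V - U" using vi loose_sub by blast
    have unhit: "spokes v i \<inter> M = {}" using vi by (auto simp: spokes_def)
    then obtain e where e: "e \<in> spokes v i" "e \<notin> B"
      using not_filled[OF danger spokes_target[OF v vi(2)]] by blast
    then have "e \<in> E - (M \<union> B)" using unhit by (auto simp: spokes_def)
    moreover have "M \<inter> spokes v i = {}" using unhit by blast
    ultimately show ?thesis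
      using e(1) v vi(1,2) no_avail by (intro good_moveI[of e] max) blast+
  qed
qed

text \<open>
  The clause on the danger anticipates Breaker's next move, because the potential is only controlled
  after his moves. The last clause records why Maker attached a vertex to the core. Both
  reasons persist: Breaker's edges remain, and when no matching can be extended any more, the set of
  loose vertices is frozen.
\<close>

definition invariant :: "'a set set \<Rightarrow> 'a set set \<Rightarrow> bool" where
  "invariant M B \<longleftrightarrow> M \<subseteq> E \<and> B \<subseteq> E \<and> card B \<le> b * card M \<and> real (card M) \<le> t \<and>
     (\<forall>D. D \<subseteq> E - (M \<union> B) \<longrightarrow> card D \<le> b \<longrightarrow> total_danger M (B \<union> D) \<le> total_danger {} {}) \<and>
     matched M \<and>
     M \<subseteq> all_edges U \<union> class_edges \<union> (\<Union>(v, i)\<in>(V - U) \<times> {..<k}. spokes v i) \<and>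
     (\<forall>v\<in>V - U. \<forall>i<k. card (M \<inter> spokes v i) \<le> 1) \<and>
     (\<forall>v\<in>V - U. \<forall>i<k. M \<inter> spokes v i \<noteq> {} \<longrightarrow>
        \<tau> \<le> card (B \<inter> spokes v i) \<or> (v \<in> loose M \<and> \<not> (\<exists>e. available M B e)))"

lemma card_heavy_spokes:
  assumes "B \<subseteq> E"
  shows "\<tau> * card {(v, i). v \<in> V - U \<and> i < k \<and> \<tau> \<le> card (B \<inter> spokes v i)} \<le> card B"
proof -
  define Z where "Z = {(v, i). v \<in> V - U \<and> i < k \<and> \<tau> \<le> card (B \<inter> spokes v i)}"
  have finB: "finite B" using assms finite_E finite_subset by blast
  have "Z \<subseteq> (V - U) \<times> {..<k}" by (auto simp: Z_def)
  then have finZ: "finite Z" using finite_V by (meson finite_Diff finite_SigmaI finite_lessThan finite_subset)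
  have "\<tau> * card Z = (\<Sum>p\<in>Z. \<tau>)" by simp
  also have "\<dots> \<le> (\<Sum>p\<in>Z. card (B \<inter> (\<lambda>(v, i). spokes v i) p))"
    by (intro sum_mono) (auto simp: Z_def)
  also have "\<dots> = card (\<Union>p\<in>Z. B \<inter> (\<lambda>(v, i). spokes v i) p)"
  proof (intro card_UN_disjoint[symmetric] finZ ballI impI)
    fix p p' assume p: "p \<in> Z" "p' \<in> Z" "p \<noteq> p'"
    obtain v i w j where vw: "p = (v, i)" "p' = (w, j)" by force
    have "spokes v i \<inter> spokes w j = {}"
      using spokes_disjoint[of v i w j] p by (auto simp: Z_def vw)
    then show "B \<inter> (\<lambda>(v, i). spokes v i) p \<inter> (B \<inter> (\<lambda>(v, i). spokes v i) p') = {}"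
      by (auto simp: vw)
  qed (use finB in auto)
  also have "\<dots> \<le> card B" using finB by (intro card_mono) auto
  finally show ?thesis by (simp add: Z_def)
qed

text \<open>
  When no matching can be extended, all edges between the unmatched vertices of two adjacent classes
  are claimed, so there are too few of them for both sides to be large.
\<close>

lemma few_loose:
  assumes M: "M \<subseteq> E" "matched M" and B: "B \<subseteq> E"
    and few: "card M + card B \<le> (b + 1) * (2 * k * card V)"
    and none: "\<not> (\<exists>e. available M B e)"
  shows "card (loose M) \<le> 2 * (k - 1) * q + ((k - 1) * L)\<^sup>2 * s"
proof (rule card_loose_le)
  fix I J assume IJ: "I \<in> classes" "J \<in> classes" "adj I J"
  show "card (unmatched M I J) \<le> s"
  proof (rule ccontr)
    assume "\<not> card (unmatched M I J) \<le> s"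
    then have s: "s \<le> card (unmatched M I J)" "s \<le> card (unmatched M J I)"
      using card_unmatched_le[OF M(2) IJ(2,1)] adj_sym[of I J] IJ by auto
    have sub: "unmatched M I J \<subseteq> C I" "unmatched M J I \<subseteq> C J" by (auto simp: unmatched_def)
    have "C I \<inter> C J = {}" using C_disj IJ adj_irrefl by metis
    then have disj: "unmatched M I J \<inter> unmatched M J I = {}" using sub by blast
    have inW: "unmatched M I J \<subseteq> V - U" "unmatched M J I \<subseteq> V - U"
      using sub C_sub IJ by blast+
    have "E \<inter> pairs (unmatched M I J) (unmatched M J I) \<subseteq> M \<union> B"
      using none IJ unfolding available_def by blast
    moreover have "finite (M \<union> B)" using M B finite_E finite_subset by blast
    ultimately have "card (E \<inter> pairs (unmatched M I J) (unmatched M J I)) \<le> card M + card B"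
      by (meson card_Un_le card_mono order_trans)
    then show False using spread[OF inW disj s] few by linarith
  qed
qed (rule L_ge)

text \<open>
  Maker owns at most one edge between a vertex and a part. Charge it to the \<open>\<tau>\<close> edges that Breaker owns
  there, or to the loose vertex. The a priori bound on Maker's edges limits Breaker's edges to
  \<open>O(n)\<close>; the resulting bound \<open>t\<close> is stronger, so the a priori bound holds after the next move as well.
\<close>

lemma card_Maker_le:
  assumes M: "M \<subseteq> E" "matched M" and B: "B \<subseteq> E" and cB: "card B \<le> b * card M"
    and cM: "card M \<le> 2 * k * card V"
    and types: "M \<subseteq> all_edges U \<union> class_edges \<union> (\<Union>(v, i)\<in>(V - U) \<times> {..<k}. spokes v i)"
    and once: "\<forall>v\<in>V - U. \<forall>i<k. card (M \<inter> spokes v i) \<le> 1"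
    and reason: "\<forall>v\<in>V - U. \<forall>i<k. M \<inter> spokes v i \<noteq> {} \<longrightarrow>
        \<tau> \<le> card (B \<inter> spokes v i) \<or> (v \<in> loose M \<and> \<not> (\<exists>e. available M B e))"
  shows "real (card M) \<le> t"
proof -
  define hit where "hit = {p\<in>(V - U) \<times> {..<k}. M \<inter> (\<lambda>(v, i). spokes v i) p \<noteq> {}}"
  define heavy where "heavy = {(v, i). v \<in> V - U \<and> i < k \<and> \<tau> \<le> card (B \<inter> spokes v i)}"
  define rest where "rest = (if \<exists>e. available M B e then {} else loose M \<times> {..<k})"
  define d where "d = 2 * (k - 1) * q + ((k - 1) * L)\<^sup>2 * s"
  have finM: "finite M" using M finite_E finite_subset by blast
  have fin: "finite ((V - U) \<times> {..<k})" using finite_V by auto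
  have finheavy: "finite heavy" by (rule finite_subset[OF _ fin]) (auto simp: heavy_def)
  have finrest: "finite rest"
    by (rule finite_subset[OF _ fin]) (use loose_sub in \<open>auto simp: rest_def\<close>)
  have "card M \<le> card ((M \<inter> all_edges U) \<union> (M \<inter> class_edges) \<union> (\<Union>p\<in>hit. M \<inter> (\<lambda>(v, i). spokes v i) p))"
    using types finM fin by (intro card_mono) (auto simp: hit_def)
  also have "\<dots> \<le> card (M \<inter> all_edges U) + card (M \<inter> class_edges) +
      card (\<Union>p\<in>hit. M \<inter> (\<lambda>(v, i). spokes v i) p)"
    by (meson add_mono card_Un_le order_refl order_trans)
  also have "card (\<Union>p\<in>hit. M \<inter> (\<lambda>(v, i). spokes v i) p) \<le> (\<Sum>p\<in>hit. card (M \<inter> (\<lambda>(v, i). spokes v i) p))"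
    using fin by (intro card_UN_le) (auto simp: hit_def)
  also have "\<dots> \<le> (\<Sum>p\<in>hit. 1)"
    using once by (intro sum_mono) (auto simp: hit_def)
  also have "\<dots> = card hit" by simp
  also have "card hit \<le> card (heavy \<union> rest)"
    using reason finheavy finrest by (intro card_mono) (auto simp: hit_def heavy_def rest_def)
  also have "\<dots> \<le> card heavy + card rest" by (rule card_Un_le)
  also have "card rest \<le> k * d"
  proof (cases "\<exists>e. available M B e")
    case False
    have "card M + card B \<le> (b + 1) * card M" using cB by simp
    also have "\<dots> \<le> (b + 1) * (2 * k * card V)" using cM by (rule mult_left_mono) simp
    finally have "card (loose M) \<le> d" unfolding d_def using few_loose M B False by blast
    then show ?thesis using False by (simp add: rest_def card_cartesian_product)
  qed (simp add: rest_def)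
  finally have "card M \<le> card (M \<inter> all_edges U) + card (M \<inter> class_edges) + (card heavy + k * d)"
    by simp
  then have "real (card M) \<le> real (card (M \<inter> all_edges U) + card (M \<inter> class_edges) + (card heavy + k * d))"
    by (rule of_nat_mono)
  then have main: "real (card M) \<le> real (card (M \<inter> all_edges U)) + real (card (M \<inter> class_edges)) +
      real (card heavy) + real k * real d" by simp
  have "card (M \<inter> all_edges U) \<le> card (E \<inter> all_edges U)"
    using M finite_E by (intro card_mono) auto
  moreover have "real (card (M \<inter> class_edges)) \<le> real k * real (card V) / 2"
  proof -
    have "2 * card (M \<inter> class_edges) \<le> k * card (V - U)" by (rule card_matching_edges[OF M(2)])
    also have "\<dots> \<le> k * card V" using finite_V by (intro mult_left_mono card_mono) auto
    finally have "real (2 * card (M \<inter> class_edges)) \<le> real (k * card V)" by (rule of_nat_mono)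
    then show ?thesis by simp
  qed
  moreover have "real (card heavy) \<le> real b * (2 * real k * real (card V)) / real \<tau>"
  proof -
    have "\<tau> * card heavy \<le> card B" unfolding heavy_def by (rule card_heavy_spokes[OF B])
    also have "\<dots> \<le> b * (2 * k * card V)" using cB cM by (meson mult_le_mono2 order_trans)
    finally have "real (\<tau> * card heavy) \<le> real (b * (2 * k * card V))" by (rule of_nat_mono)
    then show ?thesis using \<tau>_ge by (simp add: field_simps)
  qed
  ultimately show ?thesis using main t_ge unfolding d_def[symmetric] by linarith
qed

lemma invariant_start: "invariant {} {}"
proof -
  have "t \<ge> 0" using t_ge by (smt (verit) divide_nonneg_nonneg mult_nonneg_nonneg of_nat_0_le_iff)
  moreover have "total_danger {} D \<le> total_danger {} {}" if "D \<subseteq> E" "card D \<le> b" for D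
    using that finite_E total_danger_start[of D] finite_subset[of D E] by simp
  ultimately show ?thesis by (simp add: invariant_def matched_def)
qed

lemma invariant_step:
  assumes inv: "invariant M B" and not_won: "\<not> k_connected k V M"
    and D: "D \<subseteq> E - (M \<union> B)" "card D \<le> b"
  shows "\<exists>e\<in>E - (M \<union> B) - D. invariant (insert e M) (B \<union> D)"
proof -
  have M: "M \<subseteq> E" "matched M" and B: "B \<subseteq> E" and cB: "card B \<le> b * card M"
    and types: "M \<subseteq> all_edges U \<union> class_edges \<union> (\<Union>(v, i)\<in>(V - U) \<times> {..<k}. spokes v i)"
    and once: "\<And>v i. v \<in> V - U \<Longrightarrow> i < k \<Longrightarrow> card (M \<inter> spokes v i) \<le> 1"
    and reason: "\<And>v i. v \<in> V - U \<Longrightarrow> i < k \<Longrightarrow> M \<inter> spokes v i \<noteq> {} \<Longrightarrow>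
        \<tau> \<le> card (B \<inter> spokes v i) \<or> (v \<in> loose M \<and> \<not> (\<exists>e. available M B e))"
    and cM: "real (card M) \<le> t"
    and danger: "total_danger M (B \<union> D) \<le> total_danger {} {}"
    using inv D unfolding invariant_def by blast+
  obtain e where e: "good_move M (B \<union> D) e"
    using good_move_exists[OF _ not_won] danger total_danger_empty by (meson le_less_trans)
  define M' where "M' = insert e M"
  define B' where "B' = B \<union> D"
  have e_free: "e \<in> E - (M \<union> B')" using e by (simp add: good_move_def B'_def)
  have max: "\<And>e'. e' \<in> E - (M \<union> B') \<Longrightarrow> urgency M B' e' \<le> urgency M B' e"
    using e unfolding good_move_def B'_def by blast
  have kind: "e \<in> all_edges U \<or> available M B' e \<or>
      (\<exists>v\<in>V - U. \<exists>i<k. e \<in> spokes v i \<and> M \<inter> spokes v i = {} \<and>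
        (\<tau> \<le> card (B' \<inter> spokes v i) \<or> (v \<in> loose M \<and> \<not> (\<exists>e. available M B' e))))"
    using e unfolding good_move_def B'_def by blast
  have finM: "finite M" and finB': "finite B'" using M B D finite_E finite_subset
    unfolding B'_def by (blast intro: finite_subset)+
  have M': "M' \<subseteq> E" "M \<subseteq> M'" "card M' = Suc (card M)"
    using M e_free finM by (auto simp: M'_def)
  have B': "B' \<subseteq> E" "B \<subseteq> B'" using B D by (auto simp: B'_def)
  have "card B' \<le> card B + card D" unfolding B'_def by (rule card_Un_le)
  then have cB': "card B' \<le> b * card M'" using cB D M'(3) by simp
  have matched': "matched M'"
  proof (cases "available M B' e")
    case True
    then obtain I J x y where "I \<in> classes" "J \<in> classes" "adj I J"
      "x \<in> unmatched M I J" "y \<in> unmatched M J I" "e = {x, y}"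
      unfolding available_def pairs_def by blast
    then show ?thesis unfolding M'_def using matched_insert[OF M(2)] by blast
  next
    case False
    then have "\<not> e \<subseteq> V - U" using kind spokes_crosses(2) core_edge_not_outside by blast
    then have ne: "{x, y} \<noteq> e" if "x \<in> C I" "y \<in> C J" "I \<in> classes" "J \<in> classes" for x y I J
      using that C_sub[of I] C_sub[of J] by blast
    show ?thesis unfolding matched_def
    proof (intro ballI impI)
      fix I J x y y' assume a: "I \<in> classes" "J \<in> classes" "adj I J" "x \<in> C I" "y \<in> C J" "y' \<in> C J"
        "{x, y} \<in> M'" "{x, y'} \<in> M'"
      have "{x, y} \<in> M" "{x, y'} \<in> M"
        using a ne[OF a(4,5,1,2)] ne[OF a(4,6,1,2)] by (auto simp: M'_def)
      then show "y = y'" by (rule matchedD[OF M(2) a(1-6)])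
    qed
  qed
  have types': "M' \<subseteq> all_edges U \<union> class_edges \<union> (\<Union>(v, i)\<in>(V - U) \<times> {..<k}. spokes v i)"
    using types kind available_class_edge(1)[of M B' e] unfolding M'_def by blast
  have spokes': "M' \<inter> spokes v i = M \<inter> spokes v i \<or> (M \<inter> spokes v i = {} \<and> M' \<inter> spokes v i = {e} \<and>
      (\<tau> \<le> card (B' \<inter> spokes v i) \<or> (v \<in> loose M \<and> \<not> (\<exists>e. available M B' e))))"
    if vi: "v \<in> V - U" "i < k" for v i
  proof (cases "e \<in> spokes v i")
    case True
    then have "e \<notin> all_edges U" "\<not> e \<subseteq> V - U" using spokes_crosses vi by blast+
    then obtain w j where wj: "w \<in> V - U" "j < k" "e \<in> spokes w j" "M \<inter> spokes w j = {}"
        "\<tau> \<le> card (B' \<inter> spokes w j) \<or> (w \<in> loose M \<and> \<not> (\<exists>e. available M B' e))"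
      using kind available_class_edge(2)[of M B' e] by blast
    then have "v = w" "i = j" using spokes_disjoint[OF vi wj(1,2) True] by auto
    then show ?thesis using wj True by (auto simp: M'_def)
  next
    case False
    then show ?thesis by (simp add: M'_def)
  qed
  have once': "card (M' \<inter> spokes v i) \<le> 1" if "v \<in> V - U" "i < k" for v i
    using spokes'[OF that] once[OF that] by auto
  \<comment> \<open>Without available edges Maker plays in the core or attaches a vertex.\<close>
  have keep: "v \<in> loose M' \<and> \<not> (\<exists>e. available M' B' e)"
    if v: "v \<in> loose M" "\<not> (\<exists>e. available M B' e)" for v
  proof
    have "\<not> e \<subseteq> V - U" using kind v(2) spokes_crosses(2) core_edge_not_outside by blast
    then show "v \<in> loose M'" using v loose_insert_outside by (simp add: M'_def)
    show "\<not> (\<exists>e. available M' B' e)" using v(2) available_anti_mono M'(2) by blast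
  qed
  have reason': "\<tau> \<le> card (B' \<inter> spokes v i) \<or> (v \<in> loose M' \<and> \<not> (\<exists>e. available M' B' e))"
    if vi: "v \<in> V - U" "i < k" "M' \<inter> spokes v i \<noteq> {}" for v i
  proof -
    have mono: "card (B \<inter> spokes v i) \<le> card (B' \<inter> spokes v i)"
      using B' finB' by (intro card_mono) auto
    have avail: "\<not> (\<exists>e. available M B' e)" if "\<not> (\<exists>e. available M B e)"
      using that available_anti_mono B'(2) by blast
    have "\<tau> \<le> card (B' \<inter> spokes v i) \<or> (v \<in> loose M \<and> \<not> (\<exists>e. available M B' e))"
      using spokes'[OF vi(1,2)] reason[OF vi(1,2)] vi(3) mono avail by (metis order_trans)
    then show ?thesis using keep by blast
  qed
  \<comment> \<open>The bound \<open>t\<close> leaves room for one more edge below the a priori bound.\<close>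
  have "real (card M') \<le> 2 * real k * real (card V)" using cM t_le M'(3) by simp
  then have "real (card M') \<le> real (2 * k * card V)" by simp
  then have "card M' \<le> 2 * k * card V" by (simp only: of_nat_le_iff)
  then have cM': "real (card M') \<le> t"
    using card_Maker_le[OF M'(1) matched' B'(1) cB' _ types'] once' reason' by blast
  have danger': "total_danger M' (B' \<union> D') \<le> total_danger {} {}"
    if D': "D' \<subseteq> E - (M' \<union> B')" "card D' \<le> b" for D'
  proof -
    have "total_danger M' (B' \<union> D') \<le> total_danger M B'"
      unfolding M'_def
    proof (rule total_danger_step[OF _ D'(2)])
      show "finite D'" using D'(1) finite_E by (meson Diff_subset finite_subset)
      show "urgency M B' e' \<le> urgency M B' e" if "e' \<in> D'" for e'
        using that D'(1) M'(2) by (intro max) auto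
    qed
    then show ?thesis using danger by (simp add: B'_def)
  qed
  have "invariant M' B'"
    unfolding invariant_def
    by (intro conjI allI impI ballI M'(1) B'(1) cB' cM' danger' matched' types' once' reason')
  then show ?thesis using e_free unfolding M'_def B'_def by blast
qed

lemma maker_wins: "maker_wins_within 1 b E (k_connectivity_sets k V E) t"
proof (rule maker_wins_by_invariant[where Inv = invariant])
  show "finite E" by (rule finite_E)
  show "invariant {} {}" by (rule invariant_start)
  show "real (card M) \<le> t" if "invariant M B" for M B using that by (simp add: invariant_def)
  fix M B D
  assume a: "invariant M B" "M \<subseteq> E" "B \<subseteq> E" "M \<inter> B = {}"
    "\<not> (\<exists>F\<in>k_connectivity_sets k V E. F \<subseteq> M)" "D \<subseteq> E - (M \<union> B)" "card D \<le> b"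
  then have "\<not> k_connected k V M" by (auto simp: k_connectivity_sets_def)
  then show "\<exists>e\<in>E - (M \<union> B) - D. invariant (insert e M) (B \<union> D)"
    using invariant_step a by blast
qed

end

section \<open>Edge counts in the binomial random graph\<close>

lemma finite_all_edges: "finite V \<Longrightarrow> finite (all_edges V)"
  by (rule finite_subset[of _ "Pow V"]) (auto simp: all_edges_def)

text \<open>
  The number of edges in \<open>Q\<close> is a sum of independent indicators, so its exponential moment is a product.
\<close>

lemma gnp_exp_moment:
  assumes Q: "Q \<subseteq> all_edges {..<n}" and p: "0 \<le> p" "p \<le> 1"
  shows "measure_pmf.expectation (gnp n p) (\<lambda>E. exp (c * real (card (E \<inter> Q)))) =
    (1 + p * (exp c - 1)) ^ card Q"
proof -
  define A where "A = all_edges {..<n}"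
  have finA: "finite A" by (simp add: A_def finite_all_edges)
  define h where "h e x = (if e \<in> Q \<and> x then exp c else 1)" for e x
  have count: "exp (c * real (card ({e\<in>A. f e} \<inter> Q))) = (\<Prod>e\<in>A. h e (f e))" for f
  proof -
    have "(\<Prod>e\<in>A. h e (f e)) = (\<Prod>e\<in>{e\<in>A. e \<in> Q \<and> f e}. exp c)"
      unfolding h_def using finA by (intro prod.inter_filter[symmetric])
    also have "{e\<in>A. e \<in> Q \<and> f e} = {e\<in>A. f e} \<inter> Q" by auto
    finally show ?thesis by (simp add: exp_of_nat_mult[symmetric] mult.commute)
  qed
  have "measure_pmf.expectation (gnp n p) (\<lambda>E. exp (c * real (card (E \<inter> Q)))) =
      measure_pmf.expectation (Pi_pmf A False (\<lambda>_. bernoulli_pmf p)) (\<lambda>f. \<Prod>e\<in>A. h e (f e))"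
    by (simp add: gnp_def count A_def[symmetric])
  also have "\<dots> = (\<Prod>e\<in>A. measure_pmf.expectation (bernoulli_pmf p) (h e))"
    using finA by (intro expectation_prod_Pi_pmf integrable_measure_pmf_finite) (auto simp: h_def)
  also have "\<dots> = (\<Prod>e\<in>A. if e \<in> Q then 1 + p * (exp c - 1) else 1)"
    using p by (intro prod.cong refl) (auto simp: h_def algebra_simps)
  also have "\<dots> = (\<Prod>e\<in>{e\<in>A. e \<in> Q}. 1 + p * (exp c - 1))"
    using finA by (intro prod.inter_filter[symmetric])
  also have "{e\<in>A. e \<in> Q} = Q" using Q by (auto simp: A_def)
  finally show ?thesis by simp
qed

lemma set_gnp: "E \<in> set_pmf (gnp n p) \<Longrightarrow> E \<subseteq> all_edges {..<n}"
  by (auto simp: gnp_def)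

lemma finite_set_gnp: "finite (set_pmf (gnp n p))"
  by (rule finite_subset[of _ "Pow (all_edges {..<n})"]) (auto simp: finite_all_edges dest: set_gnp)

lemma gnp_tail:
  assumes Q: "Q \<subseteq> all_edges {..<n}" and p: "0 \<le> p" "p \<le> 1"
  shows "measure_pmf.prob (gnp n p) {E. c * real (card (E \<inter> Q)) \<ge> a} \<le>
    exp (p * (exp c - 1) * real (card Q) - a)"
proof -
  let ?f = "\<lambda>E :: nat set set. exp (c * real (card (E \<inter> Q)))"
  have "measure_pmf.prob (gnp n p) {E. c * real (card (E \<inter> Q)) \<ge> a} =
      measure_pmf.prob (gnp n p) {E\<in>space (measure_pmf (gnp n p)). ?f E \<ge> exp a}"
    by simp
  also have "\<dots> \<le> measure_pmf.expectation (gnp n p) ?f / exp a"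
    by (rule integral_Markov_inequality_measure[where A = "{}"])
      (auto intro: integrable_measure_pmf_finite finite_set_gnp)
  also have "\<dots> = (1 + p * (exp c - 1)) ^ card Q / exp a" by (simp add: gnp_exp_moment Q p)
  also have "\<dots> \<le> exp (p * (exp c - 1)) ^ card Q / exp a"
  proof (intro divide_right_mono power_mono exp_ge_add_one_self)
    have "0 \<le> (1 - p) + p * exp c" using p by (intro add_nonneg_nonneg mult_nonneg_nonneg) auto
    then show "0 \<le> 1 + p * (exp c - 1)" by (simp add: algebra_simps)
  qed simp
  also have "\<dots> = exp (real (card Q) * (p * (exp c - 1)) - a)"
    by (simp only: exp_diff exp_of_nat_mult)
  also have "\<dots> = exp (p * (exp c - 1) * real (card Q) - a)"
    by (simp add: mult_ac)
  finally show ?thesis .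
qed

text \<open>
  The exponential Markov inequality with parameter \<open>-1\<close>, where \<open>1 - 1/e \<ge> 1/2\<close>.
\<close>

lemma gnp_few_edges:
  assumes Q: "Q \<subseteq> all_edges {..<n}" and p: "0 \<le> p" "p \<le> 1"
  shows "measure_pmf.prob (gnp n p) {E. real (card (E \<inter> Q)) < p * real (card Q) / 4} \<le>
    exp (- p * real (card Q) / 4)"
proof -
  have "measure_pmf.prob (gnp n p) {E. real (card (E \<inter> Q)) < p * real (card Q) / 4} \<le>
      measure_pmf.prob (gnp n p) {E. (-1) * real (card (E \<inter> Q)) \<ge> - (p * real (card Q) / 4)}"
    by (intro measure_pmf.finite_measure_mono) auto
  also have "\<dots> \<le> exp (p * (exp (-1) - 1) * real (card Q) - - (p * real (card Q) / 4))"
    by (rule gnp_tail[OF assms])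
  also have "\<dots> \<le> exp (- p * real (card Q) / 4)"
  proof -
    have "exp 1 \<ge> (2::real)" using exp_ge_add_one_self[of 1] by simp
    then have "exp (-1) \<le> (1/2::real)" by (simp add: exp_minus field_simps)
    then have "(p * real (card Q)) * (exp (-1) - 1) \<le> (p * real (card Q)) * (- 1 / 2)"
      using p by (intro mult_left_mono) auto
    then show ?thesis by (simp add: algebra_simps)
  qed
  finally show ?thesis .
qed

lemma gnp_many_edges:
  assumes Q: "Q \<subseteq> all_edges {..<n}" and p: "0 \<le> p" "p \<le> 1"
  shows "measure_pmf.prob (gnp n p) {E. real (card (E \<inter> Q)) \<ge> a} \<le>
    exp (2 * p * real (card Q) - a)"
proof -
  have "measure_pmf.prob (gnp n p) {E. real (card (E \<inter> Q)) \<ge> a} \<le>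
      exp (p * (exp 1 - 1) * real (card Q) - a)"
    using gnp_tail[OF assms, of a 1] by simp
  also have "\<dots> \<le> exp (2 * p * real (card Q) - a)"
  proof -
    have "(p * real (card Q)) * (exp 1 - 1) \<le> (p * real (card Q)) * 2"
      using p exp_le by (intro mult_left_mono) auto
    then show ?thesis by (simp add: algebra_simps)
  qed
  finally show ?thesis .
qed

lemma gnp_few_edges_family:
  assumes fin: "finite T" and Q: "\<And>x. x \<in> T \<Longrightarrow> Q x \<subseteq> all_edges {..<n}" and p: "0 \<le> p" "p \<le> 1"
  shows "measure_pmf.prob (gnp n p) {E. \<exists>x\<in>T. real (card (E \<inter> Q x)) < p * real (card (Q x)) / 4} \<le>
    (\<Sum>x\<in>T. exp (- p * real (card (Q x)) / 4))"
proof -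
  have "{E. \<exists>x\<in>T. real (card (E \<inter> Q x)) < p * real (card (Q x)) / 4} =
      (\<Union>x\<in>T. {E. real (card (E \<inter> Q x)) < p * real (card (Q x)) / 4})" by auto
  then have "measure_pmf.prob (gnp n p) {E. \<exists>x\<in>T. real (card (E \<inter> Q x)) < p * real (card (Q x)) / 4} \<le>
      (\<Sum>x\<in>T. measure_pmf.prob (gnp n p) {E. real (card (E \<inter> Q x)) < p * real (card (Q x)) / 4})"
    using fin by (auto intro!: measure_pmf.finite_measure_subadditive_finite)
  also have "\<dots> \<le> (\<Sum>x\<in>T. exp (- p * real (card (Q x)) / 4))"
    using Q p by (intro sum_mono gnp_few_edges) auto
  finally show ?thesis .
qed

section \<open>Summing over cuts\<close>

lemma sum_Pow_power_card:
  fixes x :: real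
  assumes "finite A"
  shows "(\<Sum>S\<in>Pow A. x ^ card S) = (1 + x) ^ card A"
  using assms
proof induction
  case (insert a A)
  have fin: "S \<in> Pow A \<Longrightarrow> finite S" for S using insert by (auto intro: finite_subset)
  have "(\<Sum>S\<in>Pow (insert a A). x ^ card S) = (\<Sum>S\<in>Pow A. x ^ card S) + (\<Sum>S\<in>insert a ` Pow A. x ^ card S)"
    unfolding Pow_insert using insert by (intro sum.union_disjoint) auto
  also have "(\<Sum>S\<in>insert a ` Pow A. x ^ card S) = (\<Sum>S\<in>Pow A. x ^ card (insert a S))"
    using insert by (subst sum.reindex) (auto simp: inj_on_def dest: insert_ident)
  also have "\<dots> = (\<Sum>S\<in>Pow A. x * x ^ card S)"
  proof (intro sum.cong refl)
    fix S assume S: "S \<in> Pow A"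
    then have "a \<notin> S" using insert by auto
    then show "x ^ card (insert a S) = x * x ^ card S" using fin[OF S] by simp
  qed
  finally show ?case using insert by (simp add: sum_distrib_left[symmetric] algebra_simps)
qed simp

text \<open>
  Weight each subset \<open>S\<close> of the \<open>m\<close>-element set with \<open>m\<^sup>-\<^sup>|\<^sup>S\<^sup>|\<close>: the small subsets have weight at least
  \<open>m\<^sup>-\<^sup>k\<close> each, and all subsets together have weight \<open>(1 + 1/m)\<^sup>m \<le> e\<close>.
\<close>

lemma card_small_subsets_le:
  assumes U: "finite U" "U \<noteq> {}" "card U \<le> n"
  shows "real (card {S. S \<subseteq> U \<and> card S < k}) \<le> 3 * real n ^ k"
proof -
  define m where "m = card U"
  have m: "m \<ge> 1" using U by (simp add: m_def Suc_leI card_gt_0_iff)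
  have "(1 / real m) ^ k * real (card {S. S \<subseteq> U \<and> card S < k}) =
      (\<Sum>S\<in>{S. S \<subseteq> U \<and> card S < k}. (1 / real m) ^ k)" by simp
  also have "\<dots> \<le> (\<Sum>S\<in>{S. S \<subseteq> U \<and> card S < k}. (1 / real m) ^ card S)"
    using m by (intro sum_mono power_decreasing) auto
  also have "\<dots> \<le> (\<Sum>S\<in>Pow U. (1 / real m) ^ card S)"
    using U by (intro sum_mono2) auto
  also have "\<dots> = (1 + 1 / real m) ^ m" using U by (simp add: sum_Pow_power_card m_def)
  also have "\<dots> \<le> exp (1 / real m) ^ m" by (intro power_mono exp_ge_add_one_self) simp
  also have "\<dots> = exp 1" using m by (simp add: exp_of_nat_mult[symmetric])
  also have "\<dots> \<le> 3" by (rule exp_le)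
  finally have "real (card {S. S \<subseteq> U \<and> card S < k}) \<le> 3 * real m ^ k"
    using m by (simp add: field_simps power_divide)
  also have "\<dots> \<le> 3 * real n ^ k" using U by (intro mult_left_mono power_mono) (auto simp: m_def)
  finally show ?thesis .
qed

lemma sum_nonempty_subsets_le:
  fixes x :: real
  assumes U: "finite U" "card U \<le> n" and x: "0 \<le> x" "real n * x \<le> 1"
  shows "(\<Sum>A\<in>Pow U - {{}}. x ^ card A) \<le> 2 * real n * x"
proof -
  have "(\<Sum>A\<in>Pow U - {{}}. x ^ card A) = (1 + x) ^ card U - 1"
    using U by (simp add: sum_diff1 sum_Pow_power_card)
  also have "\<dots> \<le> (1 + x) ^ n - 1" using U x by (intro diff_mono power_increasing) auto
  also have "\<dots> \<le> exp x ^ n - 1" using x by (intro diff_mono power_mono exp_ge_add_one_self) auto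
  also have "\<dots> = exp (real n * x) - 1" by (simp add: exp_of_nat_mult)
  also have "\<dots> \<le> real n * x + (real n * x)\<^sup>2" using exp_bound[of "real n * x"] x by simp
  also have "\<dots> \<le> 2 * real n * x"
    using x mult_left_mono[of "real n * x" 1 "real n * x"] by (simp add: power2_eq_square mult_ac)
  finally show ?thesis .
qed

text \<open>
  This bound serves twice: with \<open>x = 2\<^sup>-\<^sup>l\<^sup>/\<^sup>b\<close> for the initial danger of the cuts, and with \<open>x = e\<^sup>-\<^sup>l\<close> for
  the probability that some cut has too few edges.
\<close>

lemma (in layered_vertices) sum_cut_choices_le:
  fixes x :: real
  assumes n: "card U \<le> n" and x: "0 \<le> x" "real n * x \<le> 1"
  shows "(\<Sum>(S, A)\<in>cut_choices. x ^ card A) \<le> 6 * real n ^ Suc k * x"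
proof -
  have "U \<noteq> {}" using U_card k_ge by auto
  have "(\<Sum>(S, A)\<in>cut_choices. x ^ card A) \<le>
      (\<Sum>(S, A)\<in>{S. S \<subseteq> U \<and> card S < k} \<times> (Pow U - {{}}). x ^ card A)"
    using finite_U x by (intro sum_mono2) (auto simp: cut_choices_def)
  also have "\<dots> = real (card {S. S \<subseteq> U \<and> card S < k}) * (\<Sum>A\<in>Pow U - {{}}. x ^ card A)"
    by (simp add: sum.cartesian_product[symmetric])
  also have "\<dots> \<le> (3 * real n ^ k) * (2 * real n * x)"
    using card_small_subsets_le[OF finite_U \<open>U \<noteq> {}\<close> n]
      sum_nonempty_subsets_le[OF finite_U n x] x
    by (intro mult_mono) (auto intro!: sum_nonneg)
  finally show ?thesis by (simp add: mult_ac)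
qed

section \<open>Concrete vertex classes\<close>

text \<open>
  The core is an initial segment of the vertices, and its parts and the classes are consecutive
  intervals. The core absorbs the remainder of the division by the number of classes, so that all
  classes have exactly the same size.
\<close>

definition block :: "nat \<Rightarrow> nat \<Rightarrow> nat \<Rightarrow> nat set" where
  "block m q j = {m + j * q..<m + Suc j * q}"

lemma card_block: "card (block m q j) = q"
  by (simp add: block_def)

lemma block_disjoint:
  assumes "i \<noteq> j"
  shows "block m q i \<inter> block m q j = {}"
proof -
  have "block m q i \<inter> block m q j = {}" if "i < j" for i j
  proof -
    have "Suc i * q \<le> j * q" using that by (intro mult_right_mono) auto
    then show ?thesis by (auto simp: block_def)
  qed
  then show ?thesis using assms by (metis Int_commute nat_neq_iff)
qed

lemma UN_block: "(\<Union>j<N. block m q j) = {m..<m + N * q}"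
proof (induction N)
  case (Suc N)
  have "(\<Union>j<Suc N. block m q j) = {m..<m + N * q} \<union> block m q N"
    using Suc by (simp add: lessThan_Suc Un_commute)
  also have "\<dots> = {m..<m + Suc N * q}" by (auto simp: block_def)
  finally show ?case .
qed simp

lemma layered_vertices_blocks:
  assumes k: "k \<ge> 2" and n: "n = m + (k - 1) * L * q" and u: "k * u \<le> m" and m: "2 * k \<le> m"
  shows "layered_vertices {..<n} {..<m} (\<lambda>(c, i). block m q (c * L + i)) (block 0 u) k L q"
proof
  show "{..<n} - {..<m} = (\<Union>I\<in>{..<k - 1} \<times> {..<L}. case I of (c, i) \<Rightarrow> block m q (c * L + i))"
  proof -
    have "(\<lambda>(c, i). c * L + i) ` ({..<k - 1} \<times> {..<L}) = {..<(k - 1) * L}"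
    proof (intro equalityI subsetI)
      fix j assume "j \<in> (\<lambda>(c, i). c * L + i) ` ({..<k - 1} \<times> {..<L})"
      then obtain c i where ci: "c < k - 1" "i < L" "j = c * L + i" by auto
      then have "j < Suc c * L" by simp
      also have "\<dots> \<le> (k - 1) * L" using ci by (intro mult_right_mono) auto
      finally show "j \<in> {..<(k - 1) * L}" by simp
    next
      fix j assume j: "j \<in> {..<(k - 1) * L}"
      then have "L > 0" by (cases L) auto
      then have "j = (j div L) * L + j mod L" "j div L < k - 1" "j mod L < L"
        using j by (auto simp: less_mult_imp_div_less)
      then show "j \<in> (\<lambda>(c, i). c * L + i) ` ({..<k - 1} \<times> {..<L})" by force
    qed
    moreover have "(\<Union>I\<in>{..<k - 1} \<times> {..<L}. case I of (c, i) \<Rightarrow> block m q (c * L + i)) =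
        (\<Union>j\<in>(\<lambda>(c, i). c * L + i) ` ({..<k - 1} \<times> {..<L}). block m q j)"
      by (simp add: case_prod_unfold)
    ultimately have "(\<Union>I\<in>{..<k - 1} \<times> {..<L}. case I of (c, i) \<Rightarrow> block m q (c * L + i)) =
        (\<Union>j<(k - 1) * L. block m q j)" by simp
    also have "\<dots> = {..<n} - {..<m}" unfolding UN_block n by auto
    finally show ?thesis ..
  qed
  show "(case I of (c, i) \<Rightarrow> block m q (c * L + i)) \<inter> (case J of (c, i) \<Rightarrow> block m q (c * L + i)) = {}"
    if IJ: "I \<in> {..<k - 1} \<times> {..<L}" "J \<in> {..<k - 1} \<times> {..<L}" "I \<noteq> J" for I J
  proof -
    obtain c i c' i' where ci: "I = (c, i)" "J = (c', i')" by force
    have "c * L + i \<noteq> c' * L + i'"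
    proof
      assume eq: "c * L + i = c' * L + i'"
      have "(c * L + i) div L = c" "(c * L + i) mod L = i"
        "(c' * L + i') div L = c'" "(c' * L + i') mod L = i'"
        using IJ ci by auto
      then show False using eq IJ ci by metis
    qed
    then show ?thesis by (simp add: ci block_disjoint)
  qed
  show "block 0 u i \<subseteq> {..<m}" if "i < k" for i
  proof -
    have "Suc i * u \<le> k * u" using that by (intro mult_right_mono) auto
    then show ?thesis using u by (auto simp: block_def)
  qed
qed (use k n m in \<open>auto simp: card_block block_disjoint\<close>)

section \<open>Winning on the random graph\<close>

text \<open>
  Here \<open>l\<close> is a lower bound for the number of edges that leave \<open>A\<close> in a cut, per vertex of \<open>A\<close>, and for the
  number of edges from a vertex to a part of the core. It has to exceed a multiple of \<open>ln n\<close> for the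
  initial danger to be small.
\<close>

lemma maker_wins_if_dense:
  fixes b k L q u m n \<tau> s :: nat and l t :: real and E :: "nat set set"
  assumes k: "k \<ge> 2" and n: "n = m + (k - 1) * L * q" and u: "k * u \<le> m" and m: "2 * k \<le> m"
    and b: "b \<ge> 1" and \<tau>: "\<tau> \<ge> 1" and L: "L \<ge> 1" and E: "E \<subseteq> all_edges {..<n}"
    and cut: "\<And>S A. \<lbrakk>S \<subseteq> {..<m}; card S < k; A \<subseteq> {..<m} - S; A \<noteq> {}; 2 * card A \<le> m\<rbrakk> \<Longrightarrow>
      real (card A) * l \<le> real (card (E \<inter> pairs A ({..<m} - S - A)))"
    and box: "\<And>v i. \<lbrakk>v \<in> {..<n} - {..<m}; i < k\<rbrakk> \<Longrightarrow> l \<le> real (card (E \<inter> pairs {v} (block 0 u i)))"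
    and spread: "\<And>A B. \<lbrakk>A \<subseteq> {..<n} - {..<m}; B \<subseteq> {..<n} - {..<m}; A \<inter> B = {}; s \<le> card A; s \<le> card B\<rbrakk> \<Longrightarrow>
      (b + 1) * (2 * k * n) < card (E \<inter> pairs A B)"
    and small: "real n * 2 powr (- l / b) \<le> 1"
      "(12 * real n ^ Suc k + real n * real k * 2 powr (1 + real \<tau> / b)) * 2 powr (- l / b) < 1"
    and t: "real (card (E \<inter> all_edges {..<m})) + real k * real n / 2 +
        real b * (2 * real k * real n) / real \<tau> +
        real k * real (2 * (k - 1) * q + ((k - 1) * L)\<^sup>2 * s) \<le> t"
      "t \<le> 2 * real k * real n - 1"
  shows "maker_wins_within 1 b E (k_connectivity_sets k {..<n} E) t"
proof -
  interpret layered_vertices "{..<n}" "{..<m}" "\<lambda>(c, i). block m q (c * L + i)" "block 0 u" k L q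
    by (rule layered_vertices_blocks[OF k n u m])
  define x where "x = (2::real) powr (- l / b)"
  have x: "0 \<le> x" "real n * x \<le> 1" using small by (auto simp: x_def)
  have "(\<Sum>(S, A)\<in>cut_choices. 2 powr (1 - real (card (E \<inter> pairs A ({..<m} - S - A))) / real b)) \<le>
      (\<Sum>(S, A)\<in>cut_choices. 2 * x ^ card A)"
  proof (intro sum_mono)
    fix p assume p: "p \<in> cut_choices"
    obtain S A where SA: "p = (S, A)" by force
    have "real (card A) * l \<le> real (card (E \<inter> pairs A ({..<m} - S - A)))"
      using p by (intro cut) (auto simp: SA cut_choices_def)
    then have "2 powr (1 - real (card (E \<inter> pairs A ({..<m} - S - A))) / real b) \<le>
        2 powr (1 + real (card A) * (- l / b))"
      using b by (intro powr_mono) (auto simp: field_simps)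
    also have "\<dots> = 2 * 2 powr (real (card A) * (- l / b))" unfolding powr_add by simp
    also have "2 powr (real (card A) * (- l / b)) = x ^ card A"
    proof -
      have "x ^ card A = x powr real (card A)" by (simp add: x_def powr_realpow)
      also have "\<dots> = 2 powr (- l / b * real (card A))" unfolding x_def by (rule powr_powr)
      finally show ?thesis by (simp only: mult.commute)
    qed
    finally show "(case p of (S, A) \<Rightarrow> 2 powr (1 - real (card (E \<inter> pairs A ({..<m} - S - A))) / real b)) \<le>
        (case p of (S, A) \<Rightarrow> 2 * x ^ card A)" by (simp add: SA)
  qed
  also have "\<dots> = 2 * (\<Sum>(S, A)\<in>cut_choices. x ^ card A)"
    by (simp add: sum_distrib_left case_prod_unfold)
  also have "\<dots> \<le> 2 * (6 * real n ^ Suc k * x)"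
    using n x by (intro mult_left_mono sum_cut_choices_le) auto
  finally have cuts: "(\<Sum>(S, A)\<in>cut_choices. 2 powr (1 - real (card (E \<inter> pairs A ({..<m} - S - A))) / real b)) \<le>
      12 * real n ^ Suc k * x" by simp
  have "(\<Sum>(v, i)\<in>({..<n} - {..<m}) \<times> {..<k}.
      2 powr (1 + (real \<tau> - real (card (E \<inter> pairs {v} (block 0 u i)))) / real b)) \<le>
      (\<Sum>(v, i)\<in>({..<n} - {..<m}) \<times> {..<k}. 2 powr (1 + real \<tau> / b) * x)"
  proof (intro sum_mono)
    fix p assume p: "p \<in> ({..<n} - {..<m}) \<times> {..<k}"
    obtain v i where vi: "p = (v, i)" by force
    have "l \<le> real (card (E \<inter> pairs {v} (block 0 u i)))" using p by (intro box) (auto simp: vi)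
    then have "2 powr (1 + (real \<tau> - real (card (E \<inter> pairs {v} (block 0 u i)))) / real b) \<le>
        2 powr ((1 + real \<tau> / b) + (- l / b))"
      using b by (intro powr_mono) (auto simp: field_simps)
    then show "(case p of (v, i) \<Rightarrow>
        2 powr (1 + (real \<tau> - real (card (E \<inter> pairs {v} (block 0 u i)))) / real b)) \<le>
        (case p of (v, i) \<Rightarrow> 2 powr (1 + real \<tau> / b) * x)"
      unfolding x_def powr_add[symmetric] by (simp add: vi)
  qed
  also have "\<dots> = real (card ({..<n} - {..<m})) * real k * (2 powr (1 + real \<tau> / b) * x)"
    by (simp add: case_prod_unfold card_cartesian_product)
  also have "\<dots> \<le> real n * real k * (2 powr (1 + real \<tau> / b) * x)"
  proof (intro mult_right_mono)
    have "card ({..<n} - {..<m}) \<le> card {..<n}" by (intro card_mono) auto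
    then show "real (card ({..<n} - {..<m})) \<le> real n" by simp
  qed (use x in auto)
  finally have boxes: "(\<Sum>(v, i)\<in>({..<n} - {..<m}) \<times> {..<k}.
      2 powr (1 + (real \<tau> - real (card (E \<inter> pairs {v} (block 0 u i)))) / real b)) \<le>
      real n * real k * 2 powr (1 + real \<tau> / b) * x" by (simp add: mult_ac)
  have "12 * real n ^ Suc k * x + real n * real k * 2 powr (1 + real \<tau> / b) * x < 1"
    using small(2) by (simp only: x_def[symmetric] distrib_right)
  then have danger: "(\<Sum>(S, A)\<in>cut_choices. 2 powr (1 - real (card (E \<inter> pairs A ({..<m} - S - A))) / real b)) +
      (\<Sum>(v, i)\<in>({..<n} - {..<m}) \<times> {..<k}.
        2 powr (1 + (real \<tau> - real (card (E \<inter> pairs {v} (block 0 u i)))) / real b)) < 1"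
    using cuts boxes by linarith
  interpret game_board "{..<n}" "{..<m}" "\<lambda>(c, i). block m q (c * L + i)" "block 0 u" k L q E b \<tau> s t
    using E b \<tau> L danger spread t by unfold_locales (simp_all only: card_lessThan)
  show ?thesis by (rule maker_wins)
qed

lemma card_all_edges_le: "card (all_edges {..<m}) \<le> m\<^sup>2"
proof -
  have "card (all_edges {..<m}) = m choose 2"
    unfolding all_edges_def using n_subsets[of "{..<m}" 2] by simp
  also have "\<dots> \<le> m\<^sup>2"
    by (cases "2 \<le> m") (simp_all add: binomial_le_pow binomial_eq_0)
  finally show ?thesis .
qed

text \<open>
  Maker wins unless some cut of the core, some pair of a vertex and a part, or some pair of large sets
  has less than a quarter of its expected number of edges, or the core has more than \<open>a\<close> edges. The error
  terms bound the probabilities of these events, the first two sharing the factor \<open>e\<^sup>-\<^sup>l\<close>. The cuts lose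
  another factor of \<open>3\<close>, since the far side of a cut is only known to contain a third of the core.
\<close>

lemma prob_maker_wins_ge:
  fixes b k L q u m n \<tau> s :: nat and l p t a :: real
  assumes k: "k \<ge> 2" and n: "n = m + (k - 1) * L * q" and u: "k * u \<le> m" and m: "6 * k \<le> m"
    and b: "b \<ge> 1" and \<tau>: "\<tau> \<ge> 1" and L: "L \<ge> 1" and p: "0 \<le> p" "p \<le> 1"
    and l: "0 \<le> l" "12 * l \<le> p * real u"
    and small: "real n * 2 powr (- l / b) \<le> 1"
      "(12 * real n ^ Suc k + real n * real k * 2 powr (1 + real \<tau> / b)) * 2 powr (- l / b) < 1"
      "real n * exp (- l) \<le> 1"
    and s: "real ((b + 1) * (2 * k * n)) < p * (real s)\<^sup>2 / 4"
    and t: "a + real k * real n / 2 +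
        real b * (2 * real k * real n) / real \<tau> +
        real k * real (2 * (k - 1) * q + ((k - 1) * L)\<^sup>2 * s) \<le> t"
      "t \<le> 2 * real k * real n - 1"
  shows "measure_pmf.prob (gnp n p) {E. maker_wins_within 1 b E (k_connectivity_sets k {..<n} E) t} \<ge>
    1 - ((6 * real n ^ Suc k + real n * real k) * exp (- l) +
         4 ^ n * exp (- p * (real s)\<^sup>2 / 4) + exp (2 * p * (real m)\<^sup>2 - a))"
proof -
  interpret layered_vertices "{..<n}" "{..<m}" "\<lambda>(c, i). block m q (c * L + i)" "block 0 u" k L q
    using m by (intro layered_vertices_blocks[OF k n u]) simp
  let ?U = "{..<m}" and ?W = "{..<n} - {..<m}" and ?P = "measure_pmf.prob (gnp n p)"
  define pw where "pw = (\<lambda>(A :: nat set, B). pairs A B)"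
  define T1 where "T1 = (\<lambda>(S, A). (A, ?U - S - A)) ` cut_choices"
  define T2 where "T2 = (\<lambda>(v, i). ({v}, block 0 u i)) ` (?W \<times> {..<k})"
  define T3 where "T3 = {(A, B). A \<subseteq> ?W \<and> B \<subseteq> ?W \<and> A \<inter> B = {} \<and> s \<le> card A \<and> s \<le> card B}"
  \<comment> \<open>The pairs of vertex sets between which edges are needed: cuts, a vertex and a part, large sets.\<close>
  define few where "few T = {E. \<exists>x\<in>T. real (card (E \<inter> pw x)) < p * real (card (pw x)) / 4}" for T
  define many where "many = {E. real (card (E \<inter> all_edges ?U)) \<ge> a}"
  define win where "win = {E. maker_wins_within 1 b E (k_connectivity_sets k {..<n} E) t}"
  have mn: "m \<le> n" using n by simp
  have sub: "pairs A B \<subseteq> all_edges {..<n}" if "A \<subseteq> {..<n}" "B \<subseteq> {..<n}" "A \<inter> B = {}" for A B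
    using that by (intro pairs_subset_all_edges)
  have T1_card: "real (card A) * (4 * l) \<le> p * real (card (pairs A (?U - S - A)))"
    if SA: "(S, A) \<in> cut_choices" for S A
  proof -
    have c: "S \<subseteq> ?U" "card S < k" "A \<subseteq> ?U - S" "2 * card A \<le> m" using SA by (auto simp: cut_choices_def)
    have fin: "finite S" "finite A" using c finite_subset[of _ ?U] by blast+
    have "card (?U - S - A) = m - card S - card A"
      using c fin by (simp add: card_Diff_subset)
    then have "3 * card (?U - S - A) \<ge> m" using c m by linarith
    moreover have "1 * u \<le> k * u" using k by (intro mult_right_mono) auto
    ultimately have "u \<le> 3 * card (?U - S - A)" using u by linarith
    then have "real u \<le> real (3 * card (?U - S - A))" by (rule of_nat_mono)
    then have "p * real u \<le> p * (3 * real (card (?U - S - A)))"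
      using p by (intro mult_left_mono) simp_all
    then have "4 * l \<le> p * real (card (?U - S - A))" using l by linarith
    then have "real (card A) * (4 * l) \<le> real (card A) * (p * real (card (?U - S - A)))"
      by (intro mult_left_mono) auto
    moreover have "A \<inter> (?U - S - A) = {}" by blast
    ultimately show ?thesis by (simp add: card_pairs mult_ac)
  qed
  have T2_card: "card (pairs {v} (block 0 u i)) = u" if "v \<in> ?W" "i < k" for v i
  proof -
    have "{v} \<inter> block 0 u i = {}" using P_sub[of i] that by auto
    then show ?thesis by (simp add: card_pairs card_block)
  qed
  have T3_card: "(real s)\<^sup>2 \<le> real (card (pairs A B))" if "(A, B) \<in> T3" for A B
  proof -
    have "s * s \<le> card A * card B" using that by (intro mult_mono) (auto simp: T3_def)
    also have "\<dots> = card (pairs A B)" using that by (intro card_pairs[symmetric]) (auto simp: T3_def)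
    finally have "real (s * s) \<le> real (card (pairs A B))" by (rule of_nat_mono)
    then show ?thesis by (simp add: power2_eq_square)
  qed
  have "?P (few T1) \<le> 6 * real n ^ Suc k * exp (- l)"
  proof -
    have "few T1 = {E. \<exists>x\<in>cut_choices. real (card (E \<inter> (case x of (S, A) \<Rightarrow> pairs A (?U - S - A)))) <
        p * real (card (case x of (S, A) \<Rightarrow> pairs A (?U - S - A))) / 4}"
      unfolding few_def T1_def pw_def by (auto simp: case_prod_unfold)
    also have "?P \<dots> \<le> (\<Sum>x\<in>cut_choices.
        exp (- p * real (card (case x of (S, A) \<Rightarrow> pairs A (?U - S - A))) / 4))"
    proof (intro gnp_few_edges_family finite_cut_choices p)
      fix x assume x: "x \<in> cut_choices"
      obtain S A where SA: "x = (S, A)" by force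
      have "pairs A (?U - S - A) \<subseteq> all_edges {..<n}"
        using x mn by (intro sub) (auto simp: SA cut_choices_def)
      then show "(case x of (S, A) \<Rightarrow> pairs A (?U - S - A)) \<subseteq> all_edges {..<n}" by (simp add: SA)
    qed
    also have "\<dots> \<le> (\<Sum>(S, A)\<in>cut_choices. exp (- l) ^ card A)"
    proof (intro sum_mono)
      fix x assume x: "x \<in> cut_choices"
      obtain S A where SA: "x = (S, A)" by force
      have "exp (- p * real (card (pairs A (?U - S - A))) / 4) \<le> exp (real (card A) * (- l))"
        using T1_card[of S A] x SA by simp
      then show "exp (- p * real (card (case x of (S, A) \<Rightarrow> pairs A (?U - S - A))) / 4) \<le>
          (case x of (S, A) \<Rightarrow> exp (- l) ^ card A)"
        unfolding exp_of_nat_mult by (simp add: SA)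
    qed
    also have "\<dots> \<le> 6 * real n ^ Suc k * exp (- l)"
      using mn small(3) by (intro sum_cut_choices_le) auto
    finally show ?thesis .
  qed
  moreover have "?P (few T2) \<le> real n * real k * exp (- l)"
  proof -
    have "few T2 = {E. \<exists>x\<in>?W \<times> {..<k}. real (card (E \<inter> (case x of (v, i) \<Rightarrow> pairs {v} (block 0 u i)))) <
        p * real (card (case x of (v, i) \<Rightarrow> pairs {v} (block 0 u i))) / 4}"
      unfolding few_def T2_def pw_def by (auto simp: case_prod_unfold)
    also have "?P \<dots> \<le> (\<Sum>x\<in>?W \<times> {..<k}.
        exp (- p * real (card (case x of (v, i) \<Rightarrow> pairs {v} (block 0 u i))) / 4))"
    proof (intro gnp_few_edges_family p)
      fix x assume x: "x \<in> ?W \<times> {..<k}"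
      obtain v i where vi: "x = (v, i)" by force
      have "block 0 u i \<subseteq> ?U" using x by (intro P_sub) (simp add: vi)
      then have "pairs {v} (block 0 u i) \<subseteq> all_edges {..<n}"
        using x mn by (intro sub) (auto simp: vi)
      then show "(case x of (v, i) \<Rightarrow> pairs {v} (block 0 u i)) \<subseteq> all_edges {..<n}" by (simp add: vi)
    qed auto
    also have "\<dots> \<le> (\<Sum>x\<in>?W \<times> {..<k}. exp (- l))"
      using l T2_card by (intro sum_mono) auto
    also have "\<dots> = real (card ?W) * real k * exp (- l)" by (simp add: card_cartesian_product)
    also have "\<dots> \<le> real n * real k * exp (- l)"
    proof (intro mult_right_mono)
      have "card ?W \<le> card {..<n}" by (intro card_mono) auto
      then show "real (card ?W) \<le> real n" by simp
    qed auto
    finally show ?thesis .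
  qed
  moreover have "?P (few T3) \<le> 4 ^ n * exp (- p * (real s)\<^sup>2 / 4)"
  proof -
    have T3: "T3 \<subseteq> Pow {..<n} \<times> Pow {..<n}" by (auto simp: T3_def)
    then have finT3: "finite T3" by (rule finite_subset) auto
    have "?P (few T3) \<le> (\<Sum>x\<in>T3. exp (- p * real (card (pw x)) / 4))"
      unfolding few_def
    proof (intro gnp_few_edges_family finT3 p)
      fix x assume x: "x \<in> T3"
      obtain A B where AB: "x = (A, B)" by force
      have "pairs A B \<subseteq> all_edges {..<n}" using x by (intro sub) (auto simp: T3_def AB)
      then show "pw x \<subseteq> all_edges {..<n}" by (simp add: AB pw_def)
    qed
    also have "\<dots> \<le> (\<Sum>x\<in>T3. exp (- p * (real s)\<^sup>2 / 4))"
      using T3_card p by (intro sum_mono) (auto simp: pw_def intro!: mult_left_mono)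
    also have "\<dots> = real (card T3) * exp (- p * (real s)\<^sup>2 / 4)" by simp
    also have "\<dots> \<le> 4 ^ n * exp (- p * (real s)\<^sup>2 / 4)"
    proof (intro mult_right_mono)
      have "card T3 \<le> card (Pow {..<n} \<times> Pow {..<n})" using T3 by (intro card_mono) auto
      also have "\<dots> = 4 ^ n" by (simp add: card_cartesian_product card_Pow power_mult_distrib[symmetric])
      finally have "real (card T3) \<le> real (4 ^ n)" by (rule of_nat_mono)
      then show "real (card T3) \<le> 4 ^ n" by simp
    qed auto
    finally show ?thesis .
  qed
  moreover have "?P many \<le> exp (2 * p * (real m)\<^sup>2 - a)"
  proof -
    have "all_edges ?U \<subseteq> all_edges {..<n}" using mn by (auto simp: all_edges_def)
    then have "?P many \<le> exp (2 * p * real (card (all_edges ?U)) - a)"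
      unfolding many_def using p by (rule gnp_many_edges)
    also have "\<dots> \<le> exp (2 * p * (real m)\<^sup>2 - a)"
    proof -
      have "real (card (all_edges ?U)) \<le> real (m\<^sup>2)" using card_all_edges_le by (rule of_nat_mono)
      then have "(2 * p) * real (card (all_edges ?U)) \<le> (2 * p) * (real m)\<^sup>2"
        using p by (intro mult_left_mono) auto
      then show ?thesis by simp
    qed
    finally show ?thesis .
  qed
  moreover have "1 \<le> ?P win + ?P (few T1) + ?P (few T2) + ?P (few T3) + ?P many"
  proof -
    have "set_pmf (gnp n p) \<subseteq> win \<union> few T1 \<union> few T2 \<union> few T3 \<union> many"
    proof
      fix E assume "E \<in> set_pmf (gnp n p)"
      then have E: "E \<subseteq> all_edges {..<n}" by (rule set_gnp)
      have "E \<in> win" if none: "E \<notin> few T1" "E \<notin> few T2" "E \<notin> few T3" "E \<notin> many"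
        unfolding win_def mem_Collect_eq
      proof (rule maker_wins_if_dense[OF k n u _ b \<tau> L E, where s = s and l = l])
        show "2 * k \<le> m" using m by simp
      next
        fix S A assume "S \<subseteq> ?U" "card S < k" "A \<subseteq> ?U - S" "A \<noteq> {}" "2 * card A \<le> m"
        then have SA: "(S, A) \<in> cut_choices" by (simp add: cut_choices_def)
        then have "(A, ?U - S - A) \<in> T1" unfolding T1_def by force
        then have "p * real (card (pairs A (?U - S - A))) / 4 \<le> real (card (E \<inter> pairs A (?U - S - A)))"
          using none(1) unfolding few_def pw_def by force
        then show "real (card A) * l \<le> real (card (E \<inter> pairs A (?U - S - A)))"
          using T1_card[OF SA] by linarith
      next
        fix v i assume vi: "v \<in> ?W" "i < k"
        then have "({v}, block 0 u i) \<in> T2" unfolding T2_def by force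
        then have "p * real (card (pairs {v} (block 0 u i))) / 4 \<le> real (card (E \<inter> pairs {v} (block 0 u i)))"
          using none(2) unfolding few_def pw_def by force
        then show "l \<le> real (card (E \<inter> pairs {v} (block 0 u i)))"
          using T2_card[OF vi] l by simp
      next
        fix A B assume "A \<subseteq> ?W" "B \<subseteq> ?W" "A \<inter> B = {}" "s \<le> card A" "s \<le> card B"
        then have AB: "(A, B) \<in> T3" by (simp add: T3_def)
        then have "p * real (card (pairs A B)) / 4 \<le> real (card (E \<inter> pairs A B))"
          using none(3) unfolding few_def pw_def by force
        moreover have "p * (real s)\<^sup>2 \<le> p * real (card (pairs A B))"
          using T3_card[OF AB] p by (intro mult_left_mono)
        ultimately have "real ((b + 1) * (2 * k * n)) < real (card (E \<inter> pairs A B))"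
          using s by linarith
        then show "(b + 1) * (2 * k * n) < card (E \<inter> pairs A B)" by (simp only: of_nat_less_iff)
      next
        have "real (card (E \<inter> all_edges ?U)) \<le> a" using none(4) by (simp add: many_def)
        then show "real (card (E \<inter> all_edges ?U)) + real k * real n / 2 +
            real b * (2 * real k * real n) / real \<tau> +
            real k * real (2 * (k - 1) * q + ((k - 1) * L)\<^sup>2 * s) \<le> t"
          using t(1) by linarith
      qed (use small t in auto)
      then show "E \<in> win \<union> few T1 \<union> few T2 \<union> few T3 \<union> many" by blast
    qed
    then have "?P (set_pmf (gnp n p)) \<le> ?P (win \<union> few T1 \<union> few T2 \<union> few T3 \<union> many)"
      by (intro measure_pmf.finite_measure_mono) auto
    moreover have "?P (set_pmf (gnp n p)) = 1"
      using measure_Int_set_pmf[of "gnp n p" UNIV] by simp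
    moreover have "?P (win \<union> few T1 \<union> few T2 \<union> few T3 \<union> many) \<le>
        ?P (win \<union> few T1 \<union> few T2 \<union> few T3) + ?P many"
      by (intro measure_Un_le) auto
    moreover have "?P (win \<union> few T1 \<union> few T2 \<union> few T3) \<le> ?P (win \<union> few T1 \<union> few T2) + ?P (few T3)"
      by (intro measure_Un_le) auto
    moreover have "?P (win \<union> few T1 \<union> few T2) \<le> ?P (win \<union> few T1) + ?P (few T2)"
      by (intro measure_Un_le) auto
    moreover have "?P (win \<union> few T1) \<le> ?P win + ?P (few T1)"
      by (intro measure_Un_le) auto
    ultimately show ?thesis by linarith
  qed
  ultimately show ?thesis unfolding win_def distrib_right by linarith
qed

section \<open>Asymptotics\<close>

lemma tendsto_power_times_exp_ln_squared:
  fixes c :: real and j :: nat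
  assumes c: "c > 0" and j: "j \<ge> 1"
  shows "(\<lambda>n::nat. real n ^ j * exp (- c * (ln (real n))\<^sup>2)) \<longlonglongrightarrow> 0"
proof -
  have j': "real j > 0" using j by simp
  have "(\<lambda>n::nat. real n powr real j * exp (- c * (ln (real n))\<^sup>2)) \<longlonglongrightarrow> 0"
    using c j' by real_asymp
  moreover have "eventually (\<lambda>n. real n powr real j * exp (- c * (ln (real n))\<^sup>2) =
      real n ^ j * exp (- c * (ln (real n))\<^sup>2)) sequentially"
    using eventually_gt_at_top[of 0] by eventually_elim (simp add: powr_realpow)
  ultimately show ?thesis by (rule Lim_transform_eventually)
qed

text \<open>
  With parts of size about \<open>x = n / ln\<^sup>K\<^sup>-\<^sup>2 n\<close> the expected number of edges from a vertex to a part is \<open>ln\<^sup>2 n\<close>,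
  which beats the union bound over cuts, while the expected number of edges in the core is of order
  \<open>n ln\<^sup>4\<^sup>-\<^sup>K n\<close>, which is \<open>o(n)\<close>. The constants \<open>L\<close>, \<open>\<tau>\<close> and \<open>\<gamma>\<close> are chosen such that the end layers, the sets
  in which Breaker becomes dangerous and the unmatched vertices, as well as the core, each cost Maker at
  most \<open>\<epsilon> n / 4\<close> moves.
\<close>

lemma prob_maker_wins_tendsto:
  fixes b k :: nat and K \<epsilon> :: real
  assumes b: "b \<ge> 1" and k: "k \<ge> 2" and K: "K > 100" and \<epsilon>: "0 < \<epsilon>" "\<epsilon> \<le> 1"
  shows "(\<lambda>n. measure_pmf.prob (gnp n (ln (real n) powr K / real n))
       {E. maker_wins_within 1 b E (k_connectivity_sets k {..<n} E)
             (real k * real n / 2 + \<epsilon> * real n)}) \<longlonglongrightarrow> 1"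
proof -
  define p where "p n = ln (real n) powr K / real n" for n
  define x where "x n = real n / ln (real n) powr (K - 2)" for n
  define L where "L = nat \<lceil>8 * real k / \<epsilon>\<rceil>"
  define \<tau> where "\<tau> = nat \<lceil>8 * real b * real k / \<epsilon>\<rceil>"
  define N where "N = (k - 1) * L"
  define \<gamma> where "\<gamma> = \<epsilon> / (4 * real k * (real N)\<^sup>2)"
  define s where "s n = nat \<lfloor>\<gamma> * real n\<rfloor>" for n
  define u where "u n = nat \<lceil>x n\<rceil>" for n
  define q where "q n = (n - k * u n) div N" for n
  define m where "m n = n - N * q n" for n
  define l where "l n = (ln (real n))\<^sup>2 / 12" for n
  define w where "w = 2 powr (1 + real \<tau> / b)"
  define c where "c = 2 * real k + real N"
  let ?win = "\<lambda>n. measure_pmf.prob (gnp n (p n)) {E. maker_wins_within 1 b E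
      (k_connectivity_sets k {..<n} E) (real k * real n / 2 + \<epsilon> * real n)}"
  define err where "err n = 6 * (real n ^ Suc k * exp (- (1/12) * (ln (real n))\<^sup>2)) +
      real k * (real n ^ 1 * exp (- (1/12) * (ln (real n))\<^sup>2)) +
      exp (real n * ln 4 - (\<gamma>\<^sup>2 / 16) * (real n * ln (real n) powr K)) +
      exp ((2 * c\<^sup>2) * (real n * ln (real n) powr (4 - K)) - (\<epsilon> / 4) * real n)" for n

  have "0 < 8 * real k / \<epsilon>" "0 < 8 * real b * real k / \<epsilon>" using k b \<epsilon> by auto
  moreover have "8 * real k / \<epsilon> \<le> real L" "8 * real b * real k / \<epsilon> \<le> real \<tau>"
    unfolding L_def \<tau>_def by linarith+
  ultimately have L: "real L \<ge> 8 * real k / \<epsilon>" "L \<ge> 1"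
    and \<tau>: "real \<tau> \<ge> 8 * real b * real k / \<epsilon>" "\<tau> \<ge> 1" by auto
  have N: "N \<ge> 1" using k L by (simp add: N_def)
  have \<gamma>: "\<gamma> > 0" using \<epsilon> k N by (simp add: \<gamma>_def)
  have c: "c > 0" using k by (simp add: c_def)

  have err: "err \<longlonglongrightarrow> 0"
  proof -
    have "(\<lambda>n::nat. exp (real n * ln 4 - (\<gamma>\<^sup>2 / 16) * (real n * ln (real n) powr K))) \<longlonglongrightarrow> 0"
    proof -
      have "\<gamma>\<^sup>2 / 16 > 0" using \<gamma> by simp
      then show ?thesis using K by real_asymp
    qed
    moreover have "(\<lambda>n::nat. exp ((2 * c\<^sup>2) * (real n * ln (real n) powr (4 - K)) - (\<epsilon> / 4) * real n)) \<longlonglongrightarrow> 0"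
    proof -
      have "2 * c\<^sup>2 > 0" "\<epsilon> / 4 > 0" using c \<epsilon> by auto
      then show ?thesis using K by real_asymp
    qed
    ultimately have "err \<longlonglongrightarrow> 6 * 0 + real k * 0 + 0 + 0"
      unfolding err_def using tendsto_power_times_exp_ln_squared[of "1/12" "Suc k"]
        tendsto_power_times_exp_ln_squared[of "1/12" 1]
      by (intro tendsto_intros) auto
    then show ?thesis by simp
  qed

  have l_powr: "2 powr (- l n / b) = exp (- (ln 2 / (12 * real b)) * (ln (real n))\<^sup>2)" for n
    by (simp add: powr_def l_def)
  have lim_small: "(\<lambda>n. real n ^ j * 2 powr (- l n / b)) \<longlonglongrightarrow> 0" if "j \<ge> 1" for j
    unfolding l_powr using b that by (intro tendsto_power_times_exp_ln_squared) auto
  have "(\<lambda>n. 12 * (real n ^ Suc k * 2 powr (- l n / b)) + real k * w * (real n ^ 1 * 2 powr (- l n / b)))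
      \<longlonglongrightarrow> 12 * 0 + real k * w * 0"
    by (intro tendsto_intros lim_small) auto
  then have small2: "eventually (\<lambda>n. 12 * (real n ^ Suc k * 2 powr (- l n / b)) +
      real k * w * (real n ^ 1 * 2 powr (- l n / b)) < 1) sequentially"
    by (intro order_tendstoD) auto
  have small1: "eventually (\<lambda>n. real n ^ 1 * 2 powr (- l n / b) < 1) sequentially"
    using lim_small[of 1] by (intro order_tendstoD) auto
  have small3: "eventually (\<lambda>n. real n ^ 1 * exp (- (1/12) * (ln (real n))\<^sup>2) < 1) sequentially"
    using tendsto_power_times_exp_ln_squared[of "1/12" 1] by (intro order_tendstoD) auto
  have x_large: "eventually (\<lambda>n. x n \<ge> 6) sequentially"
  proof -
    have "filterlim x at_top sequentially" unfolding x_def using K by real_asymp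
    then show ?thesis by (simp add: filterlim_at_top)
  qed
  have x_small: "eventually (\<lambda>n. real k * (x n + 1) \<le> real n) sequentially"
  proof -
    have "real k > 0" using k by simp
    then show ?thesis unfolding x_def using K by real_asymp
  qed
  have p_le: "eventually (\<lambda>n. p n \<le> 1) sequentially" unfolding p_def using K by real_asymp
  have dense: "eventually (\<lambda>n. real (2 * (b + 1) * k) < \<gamma>\<^sup>2 / 16 * ln (real n) powr K) sequentially"
  proof -
    have "\<gamma>\<^sup>2 / 16 > 0" using \<gamma> by simp
    then show ?thesis using K by real_asymp
  qed
  have \<gamma>n: "eventually (\<lambda>n::nat. \<gamma> * real n \<ge> 2) sequentially" using \<gamma> by real_asymp

  have lower: "eventually (\<lambda>n. 1 - err n \<le> ?win n) sequentially"
    using eventually_ge_at_top[of "3::nat"] small1 small2 small3 x_large x_small p_le dense \<gamma>n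
  proof eventually_elim
    case (elim n)
    have ln_pos: "ln (real n) > 0" using elim by (intro ln_gt_zero) auto
    have n0: "real n > 0" using elim by simp
    have p0: "p n \<ge> 0" by (simp add: p_def)
    have px: "p n * x n = (ln (real n))\<^sup>2"
    proof -
      have "p n * x n = ln (real n) powr K / ln (real n) powr (K - 2)"
        using n0 by (simp add: p_def x_def)
      also have "\<dots> = ln (real n) powr 2" by (simp add: powr_diff[symmetric])
      finally show ?thesis using ln_pos by simp
    qed
    have pxx: "p n * (x n)\<^sup>2 = real n * ln (real n) powr (4 - K)"
    proof -
      have "p n * (x n)\<^sup>2 = (p n * x n) * x n" by (simp add: power2_eq_square)
      also have "\<dots> = real n * (ln (real n) powr 2 / ln (real n) powr (K - 2))"
        unfolding px using ln_pos by (simp add: x_def)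
      also have "ln (real n) powr 2 / ln (real n) powr (K - 2) = ln (real n) powr (4 - K)"
        by (simp add: powr_diff[symmetric])
      finally show ?thesis .
    qed
    have u_bounds: "x n \<le> real (u n)" "real (u n) \<le> x n + 1"
      using elim unfolding u_def by linarith+
    have ku: "k * u n \<le> n"
    proof -
      have "real k * real (u n) \<le> real k * (x n + 1)" using u_bounds by (intro mult_left_mono) auto
      then have "real (k * u n) \<le> real n" using elim by simp
      then show ?thesis by (simp only: of_nat_le_iff)
    qed
    have Nq: "N * q n \<le> n - k * u n" "n - k * u n < N * q n + N"
      unfolding q_def using N dividend_less_times_div[of N "n - k * u n"] by (simp_all add: add.commute)
    have m: "n = m n + (k - 1) * L * q n" "k * u n \<le> m n" "m n \<le> k * u n + N"
      using Nq ku by (auto simp: m_def N_def)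
    have m6: "6 * k \<le> m n"
    proof -
      have "real (u n) \<ge> 6" using u_bounds elim by linarith
      then have "6 * k \<le> k * u n" by (simp add: mult.commute)
      then show ?thesis using m by linarith
    qed
    have pu: "12 * l n \<le> p n * real (u n)"
      using mult_left_mono[OF u_bounds(1) p0] px by (simp add: l_def)
    have ps: "\<gamma>\<^sup>2 / 16 * (real n * ln (real n) powr K) \<le> p n * (real (s n))\<^sup>2 / 4"
    proof -
      have "\<gamma> * real n / 2 \<le> real (s n)" using elim unfolding s_def by linarith
      then have "(\<gamma> * real n / 2)\<^sup>2 \<le> (real (s n))\<^sup>2" using \<gamma> by (intro power_mono) auto
      then have "p n * (\<gamma> * real n / 2)\<^sup>2 \<le> p n * (real (s n))\<^sup>2" using p0 by (rule mult_left_mono)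
      moreover have "p n * (\<gamma> * real n / 2)\<^sup>2 = 4 * (\<gamma>\<^sup>2 / 16 * (real n * ln (real n) powr K))"
        using n0 by (simp add: p_def power2_eq_square)
      ultimately show ?thesis by linarith
    qed
    have "real n * real (2 * (b + 1) * k) < real n * (\<gamma>\<^sup>2 / 16 * ln (real n) powr K)"
      using elim n0 by (intro mult_strict_left_mono) auto
    then have dense: "real ((b + 1) * (2 * k * n)) < p n * (real (s n))\<^sup>2 / 4"
      using ps by (simp add: algebra_simps)
    have small: "real n * 2 powr (- l n / b) \<le> 1"
      "(12 * real n ^ Suc k + real n * real k * 2 powr (1 + real \<tau> / b)) * 2 powr (- l n / b) < 1"
      "real n * exp (- l n) \<le> 1"
      using elim unfolding w_def l_def by (simp_all add: algebra_simps)
    have t1: "\<epsilon> / 4 * real n + real k * real n / 2 + real b * (2 * real k * real n) / real \<tau> +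
        real k * real (2 * (k - 1) * q n + ((k - 1) * L)\<^sup>2 * s n) \<le> real k * real n / 2 + \<epsilon> * real n"
    proof -
      have "real b * (2 * real k * real n) / real \<tau> \<le> \<epsilon> / 4 * real n"
      proof -
        have "8 * real b * real k \<le> \<epsilon> * real \<tau>" using \<tau>(1) \<epsilon> by (simp add: field_simps)
        then have "(8 * real b * real k) * real n \<le> (\<epsilon> * real \<tau>) * real n" by (intro mult_right_mono) auto
        then show ?thesis using \<tau>(2) by (simp add: field_simps)
      qed
      moreover have "real k * (2 * (real (k - 1) * real (q n))) \<le> \<epsilon> / 4 * real n"
      proof -
        have "(k - 1) * L * q n \<le> n" using m(1) by linarith
        then have "real ((k - 1) * L * q n) \<le> real n" by (rule of_nat_mono)
        then have a: "real L * (real (k - 1) * real (q n)) \<le> real n" by (simp add: mult_ac)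
        have "(8 * real k) * (real (k - 1) * real (q n)) \<le> (\<epsilon> * real L) * (real (k - 1) * real (q n))"
          using L(1) \<epsilon> by (intro mult_right_mono) (simp_all add: field_simps)
        also have "\<dots> = \<epsilon> * (real L * (real (k - 1) * real (q n)))" by (simp add: mult_ac)
        also have "\<dots> \<le> \<epsilon> * real n" using a \<epsilon> by (intro mult_left_mono) auto
        finally show ?thesis by simp
      qed
      moreover have "real k * ((real N)\<^sup>2 * real (s n)) \<le> \<epsilon> / 4 * real n"
      proof -
        have "real (s n) \<le> \<gamma> * real n" using \<gamma> unfolding s_def by simp
        then have "real k * ((real N)\<^sup>2 * real (s n)) \<le> real k * ((real N)\<^sup>2 * (\<gamma> * real n))"
          by (intro mult_left_mono) auto
        also have "\<dots> = \<epsilon> / 4 * real n" using k N by (simp add: \<gamma>_def)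
        finally show ?thesis .
      qed
      moreover have "real (2 * (k - 1) * q n + ((k - 1) * L)\<^sup>2 * s n) =
          2 * (real (k - 1) * real (q n)) + (real N)\<^sup>2 * real (s n)"
        unfolding N_def[symmetric] by simp
      ultimately show ?thesis by (simp only: distrib_left)
    qed
    have t2: "real k * real n / 2 + \<epsilon> * real n \<le> 2 * real k * real n - 1"
    proof -
      have "\<epsilon> * real n \<le> 1 * real n" using \<epsilon> by (intro mult_right_mono) auto
      moreover have "2 * real n \<le> real k * real n" using k by (intro mult_right_mono) auto
      ultimately show ?thesis using elim by linarith
    qed
    have "1 - ((6 * real n ^ Suc k + real n * real k) * exp (- l n) +
         4 ^ n * exp (- p n * (real (s n))\<^sup>2 / 4) + exp (2 * p n * (real (m n))\<^sup>2 - \<epsilon> / 4 * real n)) \<le> ?win n"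
      using elim k b p0 small dense t1 t2
      by (intro prob_maker_wins_ge[OF k m(1,2) m6 b \<tau>(2) L(2) p0 _ _ pu]) (auto simp: l_def)
    moreover have "(6 * real n ^ Suc k + real n * real k) * exp (- l n) =
        6 * (real n ^ Suc k * exp (- (1/12) * (ln (real n))\<^sup>2)) +
        real k * (real n ^ 1 * exp (- (1/12) * (ln (real n))\<^sup>2))"
      by (simp add: l_def algebra_simps)
    moreover have "4 ^ n * exp (- p n * (real (s n))\<^sup>2 / 4) \<le>
        exp (real n * ln 4 - (\<gamma>\<^sup>2 / 16) * (real n * ln (real n) powr K))"
    proof -
      have "(4::real) ^ n = exp (real n * ln 4)" by (simp add: exp_of_nat_mult)
      then have "4 ^ n * exp (- p n * (real (s n))\<^sup>2 / 4) =
          exp (real n * ln 4 + - p n * (real (s n))\<^sup>2 / 4)" by (simp only: exp_add)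
      then show ?thesis using ps by simp
    qed
    moreover have "exp (2 * p n * (real (m n))\<^sup>2 - \<epsilon> / 4 * real n) \<le>
        exp ((2 * c\<^sup>2) * (real n * ln (real n) powr (4 - K)) - (\<epsilon> / 4) * real n)"
    proof -
      have "real (m n) \<le> real (k * u n + N)" using m(3) by (rule of_nat_mono)
      also have "\<dots> = real k * real (u n) + real N" by simp
      also have "\<dots> \<le> real k * (x n + 1) + real N * 1"
        using u_bounds by (intro add_mono mult_left_mono) auto
      also have "\<dots> \<le> real k * (2 * x n) + real N * x n"
        using elim by (intro add_mono mult_left_mono) auto
      also have "\<dots> = c * x n" by (simp add: c_def algebra_simps)
      finally have "(real (m n))\<^sup>2 \<le> (c * x n)\<^sup>2" by (intro power_mono) auto
      then have "p n * (real (m n))\<^sup>2 \<le> p n * (c * x n)\<^sup>2" using p0 by (rule mult_left_mono)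
      also have "\<dots> = c\<^sup>2 * (p n * (x n)\<^sup>2)" by (simp add: power_mult_distrib)
      finally have "2 * p n * (real (m n))\<^sup>2 \<le> (2 * c\<^sup>2) * (real n * ln (real n) powr (4 - K))"
        unfolding pxx by simp
      then show ?thesis by simp
    qed
    ultimately show ?case unfolding err_def by linarith
  qed
  have "?win \<longlonglongrightarrow> 1"
  proof (rule tendsto_sandwich[OF lower])
    show "eventually (\<lambda>n. ?win n \<le> 1) sequentially" by simp
    show "(\<lambda>n. 1 - err n) \<longlonglongrightarrow> 1" using tendsto_diff[OF tendsto_const[of 1] err] by simp
  qed auto
  then show ?thesis unfolding p_def .
qed

lemma maker_wins_within_mono:
  "maker_wins_within a b X \<F> t \<Longrightarrow> t \<le> t' \<Longrightarrow> maker_wins_within a b X \<F> t'"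
  unfolding maker_wins_within_def by (meson order_trans)

text \<open>
  For each \<open>n\<close> take, up to \<open>1/(n + 1)\<close>, the least \<open>\<epsilon>\<close> for which an error of \<open>\<epsilon> n\<close> succeeds with probability at
  least \<open>1 - \<epsilon>\<close>. Every fixed \<open>\<epsilon>\<close> is admissible for large \<open>n\<close>, so these values tend to \<open>0\<close>.
\<close>

lemma diagonal_error_term:
  fixes P :: "nat \<Rightarrow> real \<Rightarrow> real"
  assumes mono: "\<And>n x y. x \<le> y \<Longrightarrow> P n x \<le> P n y" and bounds: "\<And>n x. 0 \<le> P n x" "\<And>n x. P n x \<le> 1"
    and lim: "\<And>\<epsilon>. 0 < \<epsilon> \<Longrightarrow> \<epsilon> \<le> 1 \<Longrightarrow> (\<lambda>n. P n (\<epsilon> * real n)) \<longlonglongrightarrow> 1"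
  shows "\<exists>g :: nat \<Rightarrow> real. g \<in> o(\<lambda>n. real n) \<and> (\<lambda>n. P n (g n)) \<longlonglongrightarrow> 1"
proof -
  define S where "S n = {\<epsilon>. 0 < \<epsilon> \<and> 1 - \<epsilon> \<le> P n (\<epsilon> * real n)}" for n
  have up: "y \<in> S n" if "x \<in> S n" "x \<le> y" for x y n
  proof -
    have "P n (x * real n) \<le> P n (y * real n)" using that by (intro mono mult_right_mono) auto
    then show ?thesis using that by (auto simp: S_def)
  qed
  have one: "1 \<in> S n" for n using bounds by (simp add: S_def)
  have bdd: "bdd_below (S n)" for n by (rule bdd_belowI[of _ 0]) (simp add: S_def)
  define \<delta> where "\<delta> n = Inf (S n) + 1 / real (Suc n)" for n
  have \<delta>_in: "\<delta> n \<in> S n" for n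
  proof -
    have "Inf (S n) < \<delta> n" by (simp add: \<delta>_def)
    then obtain x where "x \<in> S n" "x < \<delta> n" using one cInf_lessD[of "S n"] by blast
    then show ?thesis using up by (meson less_imp_le)
  qed
  have \<delta>_lim: "\<delta> \<longlonglongrightarrow> 0"
  proof (rule order_tendstoI)
    fix a :: real assume "a < 0"
    then show "eventually (\<lambda>n. a < \<delta> n) sequentially"
      using \<delta>_in by (intro always_eventually allI) (auto simp: S_def intro: less_trans)
  next
    fix a :: real assume a: "0 < a"
    define e where "e = min (a / 2) 1"
    have e: "0 < e" "e \<le> 1" "e \<le> a / 2" using a by (auto simp: e_def)
    have "eventually (\<lambda>n. 1 - e < P n (e * real n)) sequentially"
      using lim[OF e(1,2)] e by (intro order_tendstoD) auto
    moreover have "eventually (\<lambda>n. 1 / real (Suc n) < a / 2) sequentially"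
      using a by (intro order_tendstoD[OF LIMSEQ_inverse_real_of_nat[unfolded inverse_eq_divide]]) auto
    ultimately show "eventually (\<lambda>n. \<delta> n < a) sequentially"
    proof eventually_elim
      case (elim n)
      then have "e \<in> S n" using e by (simp add: S_def)
      then have "Inf (S n) \<le> e" using bdd by (rule cInf_lower)
      then show ?case using elim e by (simp add: \<delta>_def)
    qed
  qed
  define g where "g n = \<delta> n * real n" for n
  have "g \<in> o(\<lambda>n. real n)"
  proof (rule smalloI_tendsto)
    have "eventually (\<lambda>n. \<delta> n = g n / real n) sequentially"
      using eventually_gt_at_top[of 0] by eventually_elim (simp add: g_def)
    with \<delta>_lim show "(\<lambda>n. g n / real n) \<longlonglongrightarrow> 0" by (rule Lim_transform_eventually)
    show "eventually (\<lambda>n. real n \<noteq> 0) sequentially"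
      using eventually_gt_at_top[of 0] by eventually_elim simp
  qed
  moreover have "(\<lambda>n. P n (g n)) \<longlonglongrightarrow> 1"
  proof (rule tendsto_sandwich)
    show "eventually (\<lambda>n. 1 - \<delta> n \<le> P n (g n)) sequentially"
      using \<delta>_in by (intro always_eventually allI) (simp add: S_def g_def)
    show "(\<lambda>n. 1 - \<delta> n) \<longlonglongrightarrow> 1" using tendsto_diff[OF tendsto_const[of 1] \<delta>_lim] by simp
  qed (use bounds in auto)
  ultimately show ?thesis by blast
qed

theorem theorem1p3:
  fixes b k :: nat and K :: real and p :: "nat \<Rightarrow> real"
  assumes "b \<ge> 1" and "k \<ge> 2" and "K > 100"
    and "p = (\<lambda>n. ln (real n) powr K / real n)"
  shows "\<exists>g :: nat \<Rightarrow> real. g \<in> o(\<lambda>n. real n) \<and>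
    (\<lambda>n. measure_pmf.prob (gnp n (p n))
       {E. maker_wins_within 1 b E (k_connectivity_sets k {..<n} E)
             (real k * real n / 2 + g n)}) \<longlonglongrightarrow> 1"
proof (rule diagonal_error_term)
  show "(\<lambda>n. measure_pmf.prob (gnp n (p n)) {E. maker_wins_within 1 b E
      (k_connectivity_sets k {..<n} E) (real k * real n / 2 + \<epsilon> * real n)}) \<longlonglongrightarrow> 1"
    if "0 < \<epsilon>" "\<epsilon> \<le> 1" for \<epsilon>
    unfolding assms(4) using assms(1-3) that by (rule prob_maker_wins_tendsto)
  show "measure_pmf.prob (gnp n (p n)) {E. maker_wins_within 1 b E
      (k_connectivity_sets k {..<n} E) (real k * real n / 2 + x)} \<le>
    measure_pmf.prob (gnp n (p n)) {E. maker_wins_within 1 b E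
      (k_connectivity_sets k {..<n} E) (real k * real n / 2 + y)}" if "x \<le> y" for n x y
    using that by (intro measure_pmf.finite_measure_mono) (auto intro: maker_wins_within_mono)
qed auto

end
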